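(* Let $\mathbf{x}_1,\dots,\mathbf{x}_n\in\mathbb{R}^d$ be fixed and let $\mathbf{y}_1,\dots,\mathbf{y}_n$ be independent (not necessarily identically distributed) real random variables for which there is a constant $\sigma\ge0$ with $\mathbf{E}e^{t(\mathbf{y}_i-\mathbf{E}\mathbf{y}_i)}\le e^{\sigma^2t^2/2}$ for all $i$ and all $t\in\mathbb{R}$. Let $\hat A=\frac1n\sum_{i=1}^n\mathbf{x}_i\mathbf{x}_i^T$ and $a=(\sup_j\hat A_{j,j})^{1/2}$. Let $\bar\beta\in\mathbb{R}^d$ be the true target vector, i.e. $\mathbf{E}\mathbf{y}_i=\bar\beta^T\mathbf{x}_i$ for all $i$, and assume $|\mathrm{supp}_0(\bar\beta)|=k$. Let $\lambda\ge0$ be the regularization parameter and let $\hat\beta$ be the solution of $$\hat\beta=\arg\min_{\beta\in\mathbb{R}^d}\Big[\frac1n\sum_{i=1}^n(\beta^T\mathbf{x}_i-\mathbf{y}_i)^2+\lambda\|\beta\|_1\Big].$$ Let $\alpha$ be the threshold. Given $\delta\in(0,1)$, with probability larger than $1-\delta$ the following claim is true. For all $\varepsilon\in(0,1)$, if there exist an integer $\ell$ with $(d-k)/2\ge\ell\ge k$, $t\in(0,1)$ and $p\in[1,\infty]$ such that - $\lambda\ge4(2-t)t^{-1}\big(\sigma a\sqrt{2\ln(2d/\delta)/n}\big)$; and - either $8(\varepsilon\alpha\,\omega^{(p)}_{\hat A,k+\ell})^{-1}k^{1/p}\lambda\le t\le1-\pi^{(p)}_{\hat A,k+\ell,\ell}k^{1-1/p}/\ell$,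 or $8(\varepsilon\alpha\,\mu^{(p)}_{\hat A,k+\ell})^{-1}(k+\ell)^{1/p}\lambda\le t\le1-\gamma^{(p)}_{\hat A,k+\ell,\ell}k^{1-1/p}/\ell$; then $\mathrm{supp}_{(1+\varepsilon)\alpha}(\bar\beta)\subset\mathrm{supp}_\alpha(\hat\beta)\subset\mathrm{supp}_{(1-\varepsilon)\alpha}(\bar\beta)$.
   Context: For $\beta\in\mathbb{R}^d$ and $\alpha\ge0$, $\mathrm{supp}_\alpha(\beta)=\{j:|\beta_j|>\alpha\}$. $\|\cdot\|_p$ is the usual $\ell_p$ norm; $1/\infty=0$. For a positive semi-definite $A\in\mathbb{R}^{d\times d}$ and $k,\ell\ge1$ with $k+\ell\le d$, let $I,J$ range over disjoint subsets of $\{1,\dots,d\}$ with $k$ and $\ell$ elements, $A_{I,J}$ be the restriction of $A$ to row indices $I$ and column indices $J$, and $\mathbf{v}\in\mathbb{R}^k$, $\mathbf{u}\in\mathbb{R}^\ell$ range over (nonzero) vectors. (In these definitions $k,\ell$ are generic block sizes; in the claim they are evaluated at sizes $k+\ell$ and $\ell$.) Define $$\mu^{(p)}_{A,k}=\inf_{\mathbf{v},I}\frac{\|A_{I,I}\mathbf{v}\|_p}{\|\mathbf{v}\|_p},\quad \gamma^{(p)}_{A,k,\ell}=\sup_{\mathbf{u},I,J}\frac{\|A_{I,I}^{-1}A_{I,J}\mathbf{u}\|_p}{\|\mathbf{u}\|_\infty}.$$ With $\mathbf{v}^{p-1}=[|\mathbf{v}_1|^{p-1}\mathrm{sgn}(\mathbf{v}_1),\dots,|\mathbf{v}_k|^{p-1}\mathrm{sgn}(\mathbf{v}_k)]$,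 $$\omega^{(p)}_{A,k}=\inf_{\mathbf{v},I}\frac{\max(0,\mathbf{v}^TA_{I,I}\mathbf{v}^{p-1})}{\|\mathbf{v}\|_p^p},\qquad \pi^{(p)}_{A,k,\ell}=\sup_{\mathbf{v},\mathbf{u},I,J}\frac{(\mathbf{v}^{p-1})^TA_{I,J}\mathbf{u}\,\|\mathbf{v}\|_p}{\max(0,\mathbf{v}^TA_{I,I}\mathbf{v}^{p-1})\,\|\mathbf{u}\|_\infty}.$$ Reading conventions: a ratio with zero denominator is $+\infty$; $\gamma^{(p)}_{A,k,\ell}=+\infty$ if some $A_{I,I}$ with $|I|=k$ is singular; for $p=\infty$ the vector $\mathbf{v}^{p-1}/\|\mathbf{v}\|_p^{p-1}$ is understood as its limit as $p\to\infty$, i.e. the vector with entries $\mathrm{sgn}(\mathbf{v}_i)/m$ where $|\mathbf{v}_i|=\|\mathbf{v}\|_\infty$ ($m$ being the number of such $i$) and $0$ elsewhere. *)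

theory Defs
  imports "HOL-Probability.Probability"
begin

text \<open>
  A vector indexed by a subset I of the coordinates is represented by the vector of
  \<^typ>\<open>real ^ 'd\<close> that vanishes outside I, and a block with rows I and columns J by the
  \<^typ>\<open>real ^ 'd ^ 'd\<close> matrix that vanishes outside I times J. Norms, inner products and
  matrix products are unaffected by this padding. Exponents p in [1, \<infinity>] are extended reals.
\<close>

definition supp_above :: "real \<Rightarrow> real ^ 'd \<Rightarrow> 'd set" where
  "supp_above \<alpha> \<beta> = {j. \<alpha> < \<bar>\<beta> $ j\<bar>}"

definition recip :: "ereal \<Rightarrow> real" where
  "recip p = real_of_ereal (1 / p)"

definition lp_norm :: "ereal \<Rightarrow> real ^ 'd \<Rightarrow> real" where
  "lp_norm p v =
     (if p = \<infinity> then infnorm v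
      else (\<Sum>i\<in>UNIV. \<bar>v $ i\<bar> powr real_of_ereal p) powr recip p)"

text \<open>Zero denominators give \<infinity>, whatever the numerator (so also for 0/0).\<close>

definition ratio :: "ereal \<Rightarrow> ereal \<Rightarrow> ereal" where
  "ratio a b = (if b = 0 then \<infinity> else a / b)"

definition nonzero_on :: "'d set \<Rightarrow> (real ^ 'd) set" where
  "nonzero_on I = {v. v \<noteq> 0 \<and> (\<forall>i. i \<notin> I \<longrightarrow> v $ i = 0)}"

definition block :: "real ^ 'd ^ 'd \<Rightarrow> 'd set \<Rightarrow> 'd set \<Rightarrow> real ^ 'd ^ 'd" where
  "block A I J = (\<chi> i j. if i \<in> I \<and> j \<in> J then A $ i $ j else 0)"

definition is_block_inverse ::
    "real ^ 'd ^ 'd \<Rightarrow> 'd set \<Rightarrow> real ^ 'd ^ 'd \<Rightarrow> bool" where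
  "is_block_inverse A I B \<longleftrightarrow>
     block B I I = B \<and>
     block A I I ** B = block (mat 1) I I \<and>
     B ** block A I I = block (mat 1) I I"

definition block_inverse :: "real ^ 'd ^ 'd \<Rightarrow> 'd set \<Rightarrow> real ^ 'd ^ 'd" where
  "block_inverse A I = (THE B. is_block_inverse A I B)"

definition mu_coef :: "ereal \<Rightarrow> real ^ 'd ^ 'd \<Rightarrow> nat \<Rightarrow> ereal" where
  "mu_coef p A k =
     (INF I\<in>{I. card I = k}. INF v\<in>nonzero_on I.
        ratio (ereal (lp_norm p (block A I I *v v))) (ereal (lp_norm p v)))"

definition gamma_coef :: "ereal \<Rightarrow> real ^ 'd ^ 'd \<Rightarrow> nat \<Rightarrow> nat \<Rightarrow> ereal" where
  "gamma_coef p A k l =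
     (if \<exists>I. card I = k \<and> \<not> (\<exists>B. is_block_inverse A I B) then \<infinity>
      else SUP I\<in>{I. card I = k}. SUP J\<in>{J. card J = l \<and> I \<inter> J = {}}. SUP u\<in>nonzero_on J.
        ratio (ereal (lp_norm p (block_inverse A I *v (block A I J *v u))))
              (ereal (lp_norm \<infinity> u)))"

definition signed_pow :: "real ^ 'd \<Rightarrow> real \<Rightarrow> real ^ 'd" where
  "signed_pow v r = (\<chi> i. \<bar>v $ i\<bar> powr r * sgn (v $ i))"

text \<open>The limit of \<open>signed_pow v (p - 1) / lp_norm p v powr (p - 1)\<close> as p tends to \<infinity>.\<close>

definition max_sign :: "real ^ 'd \<Rightarrow> real ^ 'd" where
  "max_sign v =
     (\<chi> i. if \<bar>v $ i\<bar> = lp_norm \<infinity> v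
           then sgn (v $ i) / real (card {j. \<bar>v $ j\<bar> = lp_norm \<infinity> v}) else 0)"

text \<open>
  In the two following quotients, numerator and denominator are divided by the (p-1)-th power
  of the p-norm of v when p is \<infinity>, so that only the limit vector above occurs.
\<close>

definition omega_quot :: "ereal \<Rightarrow> real ^ 'd ^ 'd \<Rightarrow> 'd set \<Rightarrow> real ^ 'd \<Rightarrow> ereal" where
  "omega_quot p A I v =
     (if p = \<infinity> then
        ratio (ereal (max 0 (v \<bullet> (block A I I *v max_sign v)))) (ereal (lp_norm \<infinity> v))
      else
        ratio (ereal (max 0 (v \<bullet> (block A I I *v signed_pow v (real_of_ereal p - 1)))))
              (ereal (lp_norm p v powr real_of_ereal p)))"

definition pi_quot ::
    "ereal \<Rightarrow> real ^ 'd ^ 'd \<Rightarrow> 'd set \<Rightarrow> 'd set \<Rightarrow> real ^ 'd \<Rightarrow> real ^ 'd \<Rightarrow> ereal" where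
  "pi_quot p A I J v u =
     (let w = (if p = \<infinity> then max_sign v else signed_pow v (real_of_ereal p - 1))
      in ratio (ereal ((w \<bullet> (block A I J *v u)) * lp_norm p v))
               (ereal (max 0 (v \<bullet> (block A I I *v w)) * lp_norm \<infinity> u)))"

definition omega_coef :: "ereal \<Rightarrow> real ^ 'd ^ 'd \<Rightarrow> nat \<Rightarrow> ereal" where
  "omega_coef p A k = (INF I\<in>{I. card I = k}. INF v\<in>nonzero_on I. omega_quot p A I v)"

definition pi_coef :: "ereal \<Rightarrow> real ^ 'd ^ 'd \<Rightarrow> nat \<Rightarrow> nat \<Rightarrow> ereal" where
  "pi_coef p A k l =
     (SUP I\<in>{I. card I = k}. SUP J\<in>{J. card J = l \<and> I \<inter> J = {}}.
        SUP v\<in>nonzero_on I. SUP u\<in>nonzero_on J. pi_quot p A I J v u)"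

definition gram :: "nat \<Rightarrow> (nat \<Rightarrow> real ^ 'd) \<Rightarrow> real ^ 'd ^ 'd" where
  "gram n x = (\<chi> r s. (1 / real n) * (\<Sum>i=1..n. x i $ r * x i $ s))"

definition lasso_objective ::
    "nat \<Rightarrow> (nat \<Rightarrow> real ^ 'd) \<Rightarrow> (nat \<Rightarrow> real) \<Rightarrow> real \<Rightarrow> real ^ 'd \<Rightarrow> real" where
  "lasso_objective n x y lam \<beta> =
     (1 / real n) * (\<Sum>i=1..n. (\<beta> \<bullet> x i - y i)\<^sup>2) + lam * lp_norm 1 \<beta>"

abbreviation lasso_solution ::
    "nat \<Rightarrow> (nat \<Rightarrow> real ^ 'd) \<Rightarrow> (nat \<Rightarrow> real) \<Rightarrow> real \<Rightarrow> real ^ 'd \<Rightarrow> bool" where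
  "lasso_solution n x y lam \<equiv> is_arg_min (lasso_objective n x y lam) (\<lambda>_. True)"

end

theory Submission
  imports Defs
begin

text \<open>
  Write \<Delta> for the difference of the lasso solution and the target. Both inclusions of supports
  follow from the entrywise bound \<open>\<bar>\<Delta> $ j\<bar> \<le> \<epsilon> * \<alpha>\<close>, so the theorem is a bound on the sup norm of
  \<Delta>. Randomness enters through one vector only, the correlation of the noise with the columns
  of the design. Its entries are weighted sums of independent sub-Gaussian variables, and a
  Chernoff bound with a union bound over the signed coordinates
  (\<open>correlation_concentration\<close>) gives an event of probability above \<open>1 - \<delta>\<close> on which they are all at
  most \<open>s = \<sigma> * a * sqrt (2 * ln (2 * d / \<delta>) / n)\<close>. This event depends on none of
  \<open>\<epsilon>\<close>, \<open>l\<close>, \<open>t\<close>, \<open>p\<close>, and everything after it is deterministic (\<open>lasso_sup_error\<close>).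

  The optimality conditions of the lasso (\<open>lasso_optimality\<close>) say two things about \<Delta>. First, every
  entry of \<open>A *v \<Delta>\<close> is at most \<open>lam / 2 + s\<close> in absolute value, and off the support F of the target it
  never has the sign of the same entry of \<Delta>. Second, since A is positive semidefinite, \<Delta> lies in a
  cone: its l1 mass off F is at most \<open>(4 - t) / (4 - 3 * t)\<close> times its mass on F
  (\<open>lasso_cone\<close>).

  Let I be F together with the l largest entries of \<Delta> off F, and \<open>v\<close> the restriction of \<Delta> to I. The rest
  of \<Delta> is cut into blocks of l entries in decreasing order. The sup norm of each block is at most the
  average of the block before it, so the sup norms of all blocks add up to at most \<open>1 / l\<close> times the l1
  mass off F (\<open>subadditive_tail_bound\<close>). Hence \<open>pi_coef\<close>, respectively \<open>gamma_coef\<close>, controls the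
  influence of the rest of \<Delta> on the block I, and the upper bound on t in the hypothesis, together
  with the cone, leaves a fraction \<open>t / 2\<close> of the main term. In the first case the main
  term is the quadratic expression of \<open>omega_coef\<close>, in the second it is \<open>v\<close> itself, recovered from the
  rows I of \<open>A *v \<Delta>\<close> by an inverse block whose norm is controlled by \<open>mu_coef\<close>. Comparing with the upper
  bounds on \<open>A *v \<Delta>\<close> gives \<open>t * m * lp_norm p v \<le> 2 * (lam / 2 + s) * \<kappa>\<close> where m is the coefficient and \<open>\<kappa>\<close>
  is \<open>k powr recip p\<close>, respectively \<open>(k + l) powr recip p\<close> (\<open>error_bound_dual\<close>,
  \<open>error_bound_inverse\<close>). As I contains a largest entry of \<Delta> off F, the sup norm of \<Delta> is attained on
  I and is at most the p-norm of \<open>v\<close>.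

  For \<open>lam = 0\<close> the cone condition is void. Then \<open>s = 0\<close>, so the noise correlation vanishes on the event, the
  target is itself a least squares solution, and uniqueness gives \<open>\<Delta> = 0\<close>.
\<close>

section \<open>The p-norms\<close>

lemma exponent_cases:
  fixes p :: ereal
  assumes "1 \<le> p"
  obtains "p = \<infinity>" | r where "p = ereal r" "1 \<le> r"
  using assms by (cases p) auto

lemma recip_ereal [simp]: "1 \<le> r \<Longrightarrow> recip (ereal r) = 1 / r"
  by (simp add: recip_def one_ereal_def)

lemma recip_infinity [simp]: "recip \<infinity> = 0"
  by (simp add: recip_def)

lemma lp_norm_infinity [simp]: "lp_norm \<infinity> v = infnorm v"
  by (simp add: lp_norm_def)

lemma lp_norm_ereal:
  "1 \<le> r \<Longrightarrow> lp_norm (ereal r) v = (\<Sum>i\<in>UNIV. \<bar>v $ i\<bar> powr r) powr (1 / r)"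
  by (simp add: lp_norm_def)

lemma lp_norm_one: "lp_norm 1 v = (\<Sum>i\<in>UNIV. \<bar>v $ i\<bar>)"
  by (simp add: one_ereal_def lp_norm_ereal sum_nonneg)

lemma lp_norm_powr:
  "1 \<le> r \<Longrightarrow> lp_norm (ereal r) v powr r = (\<Sum>i\<in>UNIV. \<bar>v $ i\<bar> powr r)"
  by (simp add: lp_norm_ereal powr_powr sum_nonneg)

lemma lp_norm_nonneg: "1 \<le> p \<Longrightarrow> 0 \<le> lp_norm p v"
  by (auto simp: lp_norm_def infnorm_pos_le)

lemma lp_norm_zero [simp]: "1 \<le> p \<Longrightarrow> lp_norm p 0 = 0"
  by (auto simp: lp_norm_def infnorm_0 elim!: exponent_cases)

lemma component_le_lp_norm:
  assumes "1 \<le> p"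
  shows "\<bar>v $ j\<bar> \<le> lp_norm p v"
  using assms
proof (cases rule: exponent_cases)
  case 1
  then show ?thesis by (simp add: component_le_infnorm_cart)
next
  case (2 r)
  have "\<bar>v $ j\<bar> powr r \<le> (\<Sum>i\<in>UNIV. \<bar>v $ i\<bar> powr r)"
    by (rule member_le_sum) auto
  then have "(\<bar>v $ j\<bar> powr r) powr (1 / r) \<le> (\<Sum>i\<in>UNIV. \<bar>v $ i\<bar> powr r) powr (1 / r)"
    using 2 by (intro powr_mono2) auto
  then show ?thesis using 2 by (simp add: lp_norm_ereal powr_powr)
qed

lemma lp_norm_pos:
  assumes "1 \<le> p" "v \<noteq> 0"
  shows "0 < lp_norm p v"
proof -
  obtain j where "v $ j \<noteq> 0" using assms(2) by (auto simp: vec_eq_iff)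
  then show ?thesis using component_le_lp_norm[OF assms(1), of v j] by linarith
qed

lemma lp_norm_minus [simp]: "lp_norm p (- v) = lp_norm p v"
  by (simp add: lp_norm_def infnorm_neg)

lemma infnorm_le_iff:
  fixes v :: "real ^ 'd"
  shows "infnorm v \<le> c \<longleftrightarrow> (\<forall>j. \<bar>v $ j\<bar> \<le> c)"
proof
  assume "infnorm v \<le> c"
  then show "\<forall>j. \<bar>v $ j\<bar> \<le> c" using component_le_infnorm_cart order_trans by blast
next
  assume "\<forall>j. \<bar>v $ j\<bar> \<le> c"
  then show "infnorm v \<le> c" unfolding infnorm_cart by (intro cSup_least) auto
qed

lemma infnorm_attained:
  fixes v :: "real ^ 'd"
  obtains j where "\<bar>v $ j\<bar> = infnorm v"
proof -
  have "infnorm v = Max (range (\<lambda>j. \<bar>v $ j\<bar>))"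
  proof (rule antisym)
    show "infnorm v \<le> Max (range (\<lambda>j. \<bar>v $ j\<bar>))" by (auto simp: infnorm_le_iff)
    show "Max (range (\<lambda>j. \<bar>v $ j\<bar>)) \<le> infnorm v" by (auto simp: component_le_infnorm_cart)
  qed
  moreover have "Max (range (\<lambda>j. \<bar>v $ j\<bar>)) \<in> range (\<lambda>j. \<bar>v $ j\<bar>)" by (intro Max_in) auto
  ultimately show ?thesis using that by (metis (mono_tags, lifting) imageE)
qed

text \<open>For positive arguments this is \<open>powr_convex\<close>. Zero arguments, which occur as
  entries of vectors, reduce to \<open>s powr r \<le> s\<close> for s in [0, 1].\<close>

lemma powr_convex_nonneg:
  fixes x y \<theta> r :: real
  assumes "1 \<le> r" "0 \<le> x" "0 \<le> y" "0 \<le> \<theta>" "\<theta> \<le> 1"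
  shows "(\<theta> * x + (1 - \<theta>) * y) powr r \<le> \<theta> * x powr r + (1 - \<theta>) * y powr r"
proof -
  have shrink: "(s * z) powr r \<le> s * z powr r" if "0 \<le> s" "s \<le> 1" "0 \<le> z" for s z :: real
  proof -
    have "s powr r \<le> s"
      using powr_mono'[of 1 r s] that assms(1) by simp
    then show ?thesis using that by (simp add: powr_mult mult_right_mono)
  qed
  consider "x = 0" | "y = 0" | "0 < x" "0 < y" using assms by fastforce
  then show ?thesis
  proof cases
    case 3
    then show ?thesis
      using convex_onD[OF powr_convex[OF assms(1)], of "1 - \<theta>" x y] assms by simp
  qed (use assms shrink in auto)
qed

text \<open>Minkowski's inequality: with both vectors scaled to norm 1, the scaled sum is a convex
  combination, and convexity of the r-th power applies entrywise.\<close>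

lemma lp_norm_triangle:
  assumes "1 \<le> p"
  shows "lp_norm p (u + v) \<le> lp_norm p u + lp_norm p v"
  using assms
proof (cases rule: exponent_cases)
  case 1
  then show ?thesis by (simp add: infnorm_triangle)
next
  case (2 r)
  define N where "N = lp_norm p u + lp_norm p v"
  show ?thesis
  proof (cases "u = 0 \<or> v = 0")
    case True
    then show ?thesis using assms by auto
  next
    case False
    then have pos: "0 < lp_norm p u" "0 < lp_norm p v"
      using lp_norm_pos assms by auto
    then have N: "0 < N" by (simp add: N_def)
    define \<theta> where "\<theta> = lp_norm p u / N"
    have \<theta>: "0 \<le> \<theta>" "\<theta> \<le> 1" "1 - \<theta> = lp_norm p v / N"
      using pos N by (auto simp: \<theta>_def N_def field_simps)
    have comp: "(\<bar>(u + v) $ i\<bar> / N) powr r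
        \<le> \<theta> * (\<bar>u $ i\<bar> / lp_norm p u) powr r + (1 - \<theta>) * (\<bar>v $ i\<bar> / lp_norm p v) powr r" for i
    proof -
      have "\<bar>(u + v) $ i\<bar> / N \<le> \<theta> * (\<bar>u $ i\<bar> / lp_norm p u) + (1 - \<theta>) * (\<bar>v $ i\<bar> / lp_norm p v)"
        using pos N unfolding \<theta>(3) by (simp add: \<theta>_def field_simps)
      then have "(\<bar>(u + v) $ i\<bar> / N) powr r
          \<le> (\<theta> * (\<bar>u $ i\<bar> / lp_norm p u) + (1 - \<theta>) * (\<bar>v $ i\<bar> / lp_norm p v)) powr r"
        using 2 N by (intro powr_mono2) auto
      also have "\<dots> \<le> \<theta> * (\<bar>u $ i\<bar> / lp_norm p u) powr r + (1 - \<theta>) * (\<bar>v $ i\<bar> / lp_norm p v) powr r"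
        using 2 pos \<theta> by (intro powr_convex_nonneg) auto
      finally show ?thesis .
    qed
    have unit: "(\<Sum>i\<in>UNIV. (\<bar>w $ i\<bar> / lp_norm p w) powr r) = 1" if "0 < lp_norm p w"
      for w :: "real ^ 'd"
    proof -
      have "(\<Sum>i\<in>UNIV. (\<bar>w $ i\<bar> / lp_norm p w) powr r)
          = (\<Sum>i\<in>UNIV. \<bar>w $ i\<bar> powr r) / lp_norm p w powr r"
        using that by (simp add: powr_divide sum_divide_distrib)
      then show ?thesis using that 2 lp_norm_powr[of r w]
        by (metis divide_self powr_non_neg powr_gt_zero less_irrefl)
    qed
    have "(\<Sum>i\<in>UNIV. (\<bar>(u + v) $ i\<bar> / N) powr r)
        \<le> (\<Sum>i\<in>UNIV. \<theta> * (\<bar>u $ i\<bar> / lp_norm p u) powr r + (1 - \<theta>) * (\<bar>v $ i\<bar> / lp_norm p v) powr r)"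
      by (rule sum_mono) (rule comp)
    also have "\<dots> = 1"
      using unit[OF pos(1)] unit[OF pos(2)] by (simp add: sum.distrib flip: sum_distrib_left)
    finally have "(\<Sum>i\<in>UNIV. (\<bar>(u + v) $ i\<bar> / N) powr r) \<le> 1" .
    then have "(\<Sum>i\<in>UNIV. \<bar>(u + v) $ i\<bar> powr r) / N powr r \<le> 1"
      using N by (simp add: powr_divide sum_divide_distrib)
    then have "(\<Sum>i\<in>UNIV. \<bar>(u + v) $ i\<bar> powr r) \<le> N powr r" using N by simp
    then have "(\<Sum>i\<in>UNIV. \<bar>(u + v) $ i\<bar> powr r) powr (1 / r) \<le> (N powr r) powr (1 / r)"
      using 2 by (intro powr_mono2) (auto intro: sum_nonneg)
    then show ?thesis using 2 N lp_norm_ereal[of r "u + v"] by (simp add: powr_powr N_def)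
  qed
qed

text \<open>Jensen's inequality for the concave power q, by summing the tangent line at the mean. Used with
  \<open>q = 1 / p\<close> and \<open>q = (p - 1) / p\<close>, it gives both comparisons of norms that
  the proof needs.\<close>

lemma sum_powr_le:
  fixes b :: "'i \<Rightarrow> real"
  assumes "finite F" "F \<noteq> {}" "0 \<le> q" "q \<le> 1" "\<And>i. i \<in> F \<Longrightarrow> 0 \<le> b i" "0 < sum b F"
  shows "(\<Sum>i\<in>F. b i powr q) \<le> real (card F) powr (1 - q) * sum b F powr q"
proof -
  define k where "k = real (card F)"
  define m where "m = sum b F / k"
  have k: "0 < k" using assms by (simp add: k_def card_gt_0_iff)
  have m: "0 < m" using k assms by (simp add: m_def)
  have "b i powr q \<le> m powr q * (1 - q + q * (b i / m))" if "i \<in> F" for i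
  proof -
    have "(b i / m) powr q \<le> (1 - q) + q * (b i / m)"
    proof (cases "b i = 0")
      case False
      then have "0 < b i / m" using assms(5)[OF that] m by simp
      then show ?thesis
        using Youngs_inequality_0[of "1 - q" q 1 "b i / m"] assms by simp
    qed (use assms in auto)
    then have "m powr q * (b i / m) powr q \<le> m powr q * (1 - q + q * (b i / m))"
      by (intro mult_left_mono) auto
    then show ?thesis using m assms(5)[OF that] by (simp add: powr_divide)
  qed
  then have "(\<Sum>i\<in>F. b i powr q) \<le> (\<Sum>i\<in>F. m powr q * (1 - q + q * (b i / m)))"
    by (rule sum_mono)
  also have "\<dots> = m powr q * (\<Sum>i\<in>F. 1 - q + q * (b i / m))"
    by (simp add: sum_distrib_left)
  also have "(\<Sum>i\<in>F. 1 - q + q * (b i / m)) = k * (1 - q) + q * (sum b F / m)"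
    by (simp add: k_def sum.distrib sum_distrib_left sum_divide_distrib)
  also have "sum b F / m = k" using k m by (simp add: m_def field_simps)
  also have "m powr q * (k * (1 - q) + q * k) = k * m powr q"
    by (simp add: algebra_simps)
  also have "\<dots> = k powr (1 - q) * sum b F powr q"
    using k assms by (simp add: m_def powr_divide powr_diff)
  finally show ?thesis unfolding k_def .
qed

lemma l1_restrict_le_lp_norm:
  assumes "1 \<le> p" "F \<noteq> {}"
  shows "(\<Sum>i\<in>F. \<bar>v $ i\<bar>) \<le> real (card F) powr (1 - recip p) * lp_norm p v"
proof (cases "\<forall>i\<in>F. v $ i = 0")
  case True
  then show ?thesis using lp_norm_nonneg[OF assms(1), of v] by simp
next
  case False
  show ?thesis using assms(1)
  proof (cases rule: exponent_cases)
    case 1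
    have "(\<Sum>i\<in>F. \<bar>v $ i\<bar>) \<le> real (card F) * infnorm v"
      by (rule sum_bounded_above) (rule component_le_infnorm_cart)
    then show ?thesis using 1 by simp
  next
    case (2 r)
    have sub: "sum (\<lambda>i. \<bar>v $ i\<bar> powr r) F \<le> (\<Sum>i\<in>UNIV. \<bar>v $ i\<bar> powr r)"
      by (rule sum_mono2) auto
    have pos: "0 < sum (\<lambda>i. \<bar>v $ i\<bar> powr r) F"
      using False by (auto intro!: sum_pos2)
    have "(\<Sum>i\<in>F. \<bar>v $ i\<bar>) = (\<Sum>i\<in>F. (\<bar>v $ i\<bar> powr r) powr (1 / r))"
      using 2 by (simp add: powr_powr)
    also have "\<dots> \<le> real (card F) powr (1 - 1 / r) * sum (\<lambda>i. \<bar>v $ i\<bar> powr r) F powr (1 / r)"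
      using 2 assms pos by (intro sum_powr_le) auto
    also have "\<dots> \<le> real (card F) powr (1 - 1 / r) * (\<Sum>i\<in>UNIV. \<bar>v $ i\<bar> powr r) powr (1 / r)"
      using 2 sub by (intro mult_left_mono powr_mono2) (auto intro: sum_nonneg)
    finally show ?thesis using 2 by (simp add: lp_norm_ereal)
  qed
qed

lemma lp_norm_le_bound:
  assumes "1 \<le> p" "I \<noteq> {}" "\<And>i. i \<notin> I \<Longrightarrow> v $ i = 0" "\<And>i. i \<in> I \<Longrightarrow> \<bar>v $ i\<bar> \<le> c" "0 \<le> c"
  shows "lp_norm p v \<le> real (card I) powr recip p * c"
  using assms(1)
proof (cases rule: exponent_cases)
  case 1
  have "\<bar>v $ i\<bar> \<le> c" for i using assms by (cases "i \<in> I") auto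
  then show ?thesis using 1 assms by (simp add: infnorm_le_iff)
next
  case (2 r)
  have "(\<Sum>i\<in>UNIV. \<bar>v $ i\<bar> powr r) = (\<Sum>i\<in>I. \<bar>v $ i\<bar> powr r)"
    using assms by (intro sum.mono_neutral_right) auto
  also have "\<dots> \<le> (\<Sum>i\<in>I. c powr r)"
    using assms 2 by (intro sum_mono powr_mono2) auto
  finally have "(\<Sum>i\<in>UNIV. \<bar>v $ i\<bar> powr r) powr (1 / r) \<le> (real (card I) * c powr r) powr (1 / r)"
    using 2 by (intro powr_mono2) (auto intro: sum_nonneg)
  then show ?thesis using 2 assms by (simp add: lp_norm_ereal powr_mult powr_powr)
qed

section \<open>The vector dual to v\<close>

text \<open>A subgradient of the p-norm at v, up to a positive factor. This
  definition and the next treat finite and infinite p uniformly, so that the proofs below need not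
  distinguish them.\<close>

definition dual_vec :: "ereal \<Rightarrow> real ^ 'd \<Rightarrow> real ^ 'd" where
  "dual_vec p v = (if p = \<infinity> then max_sign v else signed_pow v (real_of_ereal p - 1))"

text \<open>The inner product of v with its dual vector.\<close>

definition dual_scale :: "ereal \<Rightarrow> real ^ 'd \<Rightarrow> real" where
  "dual_scale p v = (if p = \<infinity> then lp_norm p v else lp_norm p v powr real_of_ereal p)"

lemma omega_quot_dual:
  "omega_quot p A I v =
     ratio (ereal (max 0 (v \<bullet> (block A I I *v dual_vec p v)))) (ereal (dual_scale p v))"
  by (simp add: omega_quot_def dual_vec_def dual_scale_def)

lemma pi_quot_dual:
  "pi_quot p A I J v u =
     ratio (ereal ((dual_vec p v \<bullet> (block A I J *v u)) * lp_norm p v))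
           (ereal (max 0 (v \<bullet> (block A I I *v dual_vec p v)) * lp_norm \<infinity> u))"
  by (simp add: pi_quot_def dual_vec_def Let_def)

lemma dual_scale_pos: "1 \<le> p \<Longrightarrow> v \<noteq> 0 \<Longrightarrow> 0 < dual_scale p v"
  using lp_norm_pos[of p v] by (auto simp: dual_scale_def simp del: lp_norm_infinity)

lemma dual_vec_component:
  assumes "v \<noteq> 0"
  shows "dual_vec p v $ j = \<bar>dual_vec p v $ j\<bar> * sgn (v $ j)"
  using assms by (auto simp: dual_vec_def max_sign_def signed_pow_def sgn_if)

text \<open>Hoelder's inequality for a part of the dual vector. For infinite p the dual vector has l1 norm 1
  and \<open>recip p = 0\<close>.\<close>

lemma dual_vec_l1_bound:
  assumes "1 \<le> p" "v \<noteq> 0" "F \<noteq> {}"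
  shows "(\<Sum>i\<in>F. \<bar>dual_vec p v $ i\<bar>) * lp_norm p v \<le> real (card F) powr recip p * dual_scale p v"
  using assms(1)
proof (cases rule: exponent_cases)
  case 1
  define S where "S = {j. \<bar>v $ j\<bar> = infnorm v}"
  have pos: "0 < infnorm v" using assms infnorm_pos_lt by blast
  obtain j where "\<bar>v $ j\<bar> = infnorm v" by (rule infnorm_attained)
  then have S: "S \<noteq> {}" by (auto simp: S_def)
  have "(\<Sum>i\<in>F. \<bar>dual_vec p v $ i\<bar>) \<le> (\<Sum>i\<in>UNIV. \<bar>dual_vec p v $ i\<bar>)"
    by (rule sum_mono2) auto
  also have "\<dots> = (\<Sum>i\<in>UNIV. if i \<in> S then 1 / real (card S) else 0)"
    using 1 pos by (intro sum.cong) (auto simp: dual_vec_def max_sign_def S_def abs_sgn_eq)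
  also have "\<dots> = real (card S) * (1 / real (card S))" by (simp add: sum.If_cases)
  also have "\<dots> = 1" using S by simp
  finally have "(\<Sum>i\<in>F. \<bar>dual_vec p v $ i\<bar>) * infnorm v \<le> 1 * infnorm v"
    using pos by (intro mult_right_mono) auto
  then show ?thesis using 1 assms by (simp add: dual_scale_def)
next
  case (2 r)
  define q where "q = (r - 1) / r"
  have q: "0 \<le> q" "q \<le> 1" "1 - q = 1 / r" "r * q = r - 1"
    using 2 by (auto simp: q_def field_simps)
  have N: "0 < lp_norm p v" using assms lp_norm_pos by blast
  have entry: "\<bar>dual_vec p v $ i\<bar> = (if v $ i = 0 then 0 else (\<bar>v $ i\<bar> powr r) powr q)" for i
    using 2 q by (simp add: dual_vec_def signed_pow_def abs_mult powr_powr abs_sgn_eq)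
  have "(\<Sum>i\<in>F. \<bar>dual_vec p v $ i\<bar>) \<le> real (card F) powr (1 / r) * lp_norm p v powr (r - 1)"
  proof (cases "\<forall>i\<in>F. v $ i = 0")
    case True
    then have "(\<Sum>i\<in>F. \<bar>dual_vec p v $ i\<bar>) = 0" by (simp add: entry)
    then show ?thesis by simp
  next
    case False
    have sub: "sum (\<lambda>i. \<bar>v $ i\<bar> powr r) F \<le> lp_norm p v powr r"
      using 2 by (simp add: lp_norm_powr sum_mono2)
    have pos: "0 < sum (\<lambda>i. \<bar>v $ i\<bar> powr r) F"
      using False by (auto intro!: sum_pos2)
    have "(\<Sum>i\<in>F. \<bar>dual_vec p v $ i\<bar>) \<le> (\<Sum>i\<in>F. (\<bar>v $ i\<bar> powr r) powr q)"
      by (intro sum_mono) (simp add: entry)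
    also have "\<dots> \<le> real (card F) powr (1 - q) * sum (\<lambda>i. \<bar>v $ i\<bar> powr r) F powr q"
      using q assms pos by (intro sum_powr_le) auto
    also have "\<dots> \<le> real (card F) powr (1 - q) * (lp_norm p v powr r) powr q"
      using q sub pos by (intro mult_left_mono powr_mono2) auto
    finally show ?thesis using q by (simp add: powr_powr)
  qed
  then have "(\<Sum>i\<in>F. \<bar>dual_vec p v $ i\<bar>) * lp_norm p v
      \<le> (real (card F) powr (1 / r) * lp_norm p v powr (r - 1)) * lp_norm p v"
    using N by (intro mult_right_mono) auto
  also have "\<dots> = real (card F) powr (1 / r) * lp_norm p v powr r"
    using N by (simp add: powr_diff)
  finally show ?thesis using 2 by (simp add: dual_scale_def)
qed

section \<open>Blocks of vectors and matrices\<close>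

definition restrict_vec :: "'d set \<Rightarrow> real ^ 'd \<Rightarrow> real ^ 'd" where
  "restrict_vec S v = (\<chi> i. if i \<in> S then v $ i else 0)"

lemma restrict_vec_component [simp]: "restrict_vec S v $ i = (if i \<in> S then v $ i else 0)"
  by (simp add: restrict_vec_def)

lemma restrict_vec_zero [simp]: "restrict_vec S 0 = 0"
  by (simp add: vec_eq_iff)

lemma restrict_vec_minus: "restrict_vec S (- v) = - restrict_vec S v"
  by (simp add: vec_eq_iff)

lemma matrix_vector_mult_uminus: "A *v (- u) = - (A *v u)" for A :: "real ^ 'n ^ 'm"
  by (simp add: vec_eq_iff matrix_vector_mult_def sum_negf)

lemma restrict_vec_Un: "S \<inter> T = {} \<Longrightarrow> restrict_vec (S \<union> T) v = restrict_vec S v + restrict_vec T v"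
  by (auto simp: vec_eq_iff)

lemma restrict_vec_add: "restrict_vec S (u + v) = restrict_vec S u + restrict_vec S v"
  by (auto simp: vec_eq_iff)

lemma block_mult_vec:
  assumes "\<And>j. j \<notin> J \<Longrightarrow> u $ j = 0"
  shows "block A I J *v u = restrict_vec I (A *v u)"
proof -
  have "(block A I J *v u) $ i = restrict_vec I (A *v u) $ i" for i
    by (cases "i \<in> I") (auto simp: block_def matrix_vector_mult_def assms intro!: sum.cong)
  then show ?thesis by (simp add: vec_eq_iff)
qed

lemma block_unit_mult_vec: "block (mat 1) I I *v u = restrict_vec I u"
proof -
  have "(block (mat 1) I I *v u) $ i = restrict_vec I u $ i" for i
  proof -
    have "(\<Sum>k\<in>UNIV. (if i \<in> I \<and> k \<in> I then mat 1 $ i $ k else 0) * u $ k)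
        = (\<Sum>k\<in>UNIV. if k = i then (if i \<in> I then u $ k else 0) else 0)"
      by (rule sum.cong) (auto simp: mat_def)
    then show ?thesis by (simp add: block_def matrix_vector_mult_def)
  qed
  then show ?thesis by (simp add: vec_eq_iff)
qed

lemma is_block_inverse_unique:
  fixes A B C :: "real ^ 'd ^ 'd"
  assumes "is_block_inverse A I B" "is_block_inverse A I C"
  shows "B = C"
proof -
  have unit: "block (mat 1) I I ** M = M" if "block M I I = M" for M :: "real ^ 'd ^ 'd"
  proof -
    have "(block (mat 1) I I ** M) $ i $ j = M $ i $ j" for i j
    proof -
      have "M $ i $ j = block M I I $ i $ j" using that by simp
      moreover have "(\<Sum>k\<in>UNIV. (if i \<in> I \<and> k \<in> I then mat 1 $ i $ k else 0) * M $ k $ j)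
          = (\<Sum>k\<in>UNIV. if k = i then (if i \<in> I then M $ k $ j else 0) else 0)"
        by (rule sum.cong) (auto simp: mat_def)
      ultimately show ?thesis by (auto simp: block_def matrix_matrix_mult_def)
    qed
    then show ?thesis by (simp add: vec_eq_iff)
  qed
  have unit': "M ** block (mat 1) I I = M" if "block M I I = M" for M :: "real ^ 'd ^ 'd"
  proof -
    have "(M ** block (mat 1) I I) $ i $ j = M $ i $ j" for i j
    proof -
      have "M $ i $ j = block M I I $ i $ j" using that by simp
      moreover have "(\<Sum>k\<in>UNIV. M $ i $ k * (if k \<in> I \<and> j \<in> I then mat 1 $ k $ j else 0))
          = (\<Sum>k\<in>UNIV. if k = j then (if j \<in> I then M $ i $ k else 0) else 0)"
        by (rule sum.cong) (auto simp: mat_def)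
      ultimately show ?thesis by (auto simp: block_def matrix_matrix_mult_def)
    qed
    then show ?thesis by (simp add: vec_eq_iff)
  qed
  have "B = B ** (block A I I ** C)" using assms unit' by (auto simp: is_block_inverse_def)
  also have "\<dots> = (B ** block A I I) ** C" by (rule matrix_mul_assoc)
  also have "\<dots> = C" using assms unit by (auto simp: is_block_inverse_def)
  finally show ?thesis .
qed

lemma is_block_inverse_block_inverse:
  assumes "is_block_inverse A I B"
  shows "is_block_inverse A I (block_inverse A I)"
  unfolding block_inverse_def
  by (rule theI[where P = "is_block_inverse A I", OF assms is_block_inverse_unique[OF _ assms]])

section \<open>Cutting the tail of a vector into blocks of decreasing size\<close>

lemma exists_largest_subset:
  fixes f :: "'i \<Rightarrow> real"
  assumes "finite S" "l \<le> card S"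
  shows "\<exists>J\<subseteq>S. card J = l \<and> (\<forall>j\<in>J. \<forall>i\<in>S - J. f i \<le> f j)"
  using assms(2)
proof (induction l)
  case 0
  then show ?case by (intro exI[of _ "{}"]) auto
next
  case (Suc l)
  then obtain J where J: "J \<subseteq> S" "card J = l" "\<forall>j\<in>J. \<forall>i\<in>S - J. f i \<le> f j" by auto
  have fin: "finite J" "finite (S - J)" using J assms finite_subset by auto
  have ne: "S - J \<noteq> {}" using J Suc.prems fin card_mono[of J S] by auto
  define m where "m = arg_min_on (\<lambda>i. - f i) (S - J)"
  have m: "m \<in> S - J" "\<forall>i\<in>S - J. f i \<le> f m"
    using arg_min_if_finite[OF fin(2) ne, of "\<lambda>i. - f i"] by (auto simp: m_def not_less)
  then show ?case
    using J fin by (intro exI[of _ "insert m J"]) auto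
qed

text \<open>The sup norm of a block of l entries is at most the average of any l entries that dominate it.
  Cutting off the l largest entries of T repeatedly, each block is charged to the block before it, and the
  first one to \<open>J0\<close>, so that every entry is used once. The last block may be shorter than l. It is
  padded by further indices from R, which is why R must have at least l elements.

  The function \<open>\<Phi>\<close> is linear in one application and a norm in the other.\<close>

lemma subadditive_tail_bound:
  fixes \<Phi> :: "real ^ 'd \<Rightarrow> real"
  assumes sub: "\<And>u w. \<Phi> (u + w) \<le> \<Phi> u + \<Phi> w" and zero: "\<Phi> 0 = 0"
    and bound: "\<And>J u. J \<subseteq> R \<Longrightarrow> card J = l \<Longrightarrow> u \<in> nonzero_on J \<Longrightarrow> \<Phi> u \<le> c * infnorm u"
    and c: "0 \<le> c" and l: "1 \<le> l" "l \<le> card R"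
    and T: "T \<subseteq> R" "J0 \<inter> T = {}" "card J0 = l"
    and top: "\<forall>j\<in>J0. \<forall>i\<in>T. \<bar>v $ i\<bar> \<le> \<bar>v $ j\<bar>"
  shows "\<Phi> (restrict_vec T v) \<le> c * ((\<Sum>i\<in>J0 \<union> T. \<bar>v $ i\<bar>) / real l)"
  using T top
proof (induction "card T" arbitrary: T J0 rule: less_induct)
  case less
  have short: "\<Phi> (restrict_vec U v) \<le> c * ((\<Sum>i\<in>J0. \<bar>v $ i\<bar>) / real l)"
    if U: "U \<subseteq> T" "card U \<le> l" for U
  proof (cases "restrict_vec U v = 0")
    case True
    then show ?thesis using zero c by (simp add: sum_nonneg)
  next
    case False
    obtain J where J: "U \<subseteq> J" "J \<subseteq> R" "card J = l"
      using exists_subset_between[of U l R] U less.prems l by auto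
    have "\<bar>v $ i\<bar> \<le> (\<Sum>j\<in>J0. \<bar>v $ j\<bar>) / real l" if "i \<in> U" for i
    proof -
      have "real (card J0) * \<bar>v $ i\<bar> \<le> (\<Sum>j\<in>J0. \<bar>v $ j\<bar>)"
        using less.prems(4) that U by (intro sum_bounded_below) auto
      then show ?thesis using less.prems l by (simp add: field_simps)
    qed
    then have "infnorm (restrict_vec U v) \<le> (\<Sum>j\<in>J0. \<bar>v $ j\<bar>) / real l"
      by (auto simp: infnorm_le_iff sum_nonneg)
    moreover have "\<Phi> (restrict_vec U v) \<le> c * infnorm (restrict_vec U v)"
      using J False by (intro bound[of J]) (auto simp: nonzero_on_def)
    ultimately show ?thesis using c mult_left_mono order_trans by blast
  qed
  show ?case
  proof (cases "card T \<le> l")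
    case True
    have "(\<Sum>i\<in>J0. \<bar>v $ i\<bar>) \<le> (\<Sum>i\<in>J0 \<union> T. \<bar>v $ i\<bar>)" by (rule sum_mono2) auto
    then have "c * ((\<Sum>i\<in>J0. \<bar>v $ i\<bar>) / real l) \<le> c * ((\<Sum>i\<in>J0 \<union> T. \<bar>v $ i\<bar>) / real l)"
      using c by (intro mult_left_mono divide_right_mono) auto
    then show ?thesis using short[of T] True by simp
  next
    case False
    then obtain J where J: "J \<subseteq> T" "card J = l" "\<forall>j\<in>J. \<forall>i\<in>T - J. \<bar>v $ i\<bar> \<le> \<bar>v $ j\<bar>"
      using exists_largest_subset[of T l "\<lambda>i. \<bar>v $ i\<bar>"] by auto
    have dec: "card (T - J) < card T" using J l False by (simp add: card_Diff_subset)
    have "\<Phi> (restrict_vec T v) = \<Phi> (restrict_vec J v + restrict_vec (T - J) v)"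
      using restrict_vec_Un[of J "T - J" v] J by (simp add: Un_absorb1)
    also have "\<dots> \<le> \<Phi> (restrict_vec J v) + \<Phi> (restrict_vec (T - J) v)" by (rule sub)
    also have "\<dots> \<le> c * ((\<Sum>i\<in>J0. \<bar>v $ i\<bar>) / real l) + c * ((\<Sum>i\<in>J \<union> (T - J). \<bar>v $ i\<bar>) / real l)"
      using short[of J] less.hyps[OF dec, of J] J less.prems by (intro add_mono) auto
    also have "\<dots> = c * ((\<Sum>i\<in>J0 \<union> T. \<bar>v $ i\<bar>) / real l)"
      using J less.prems by (simp add: Un_absorb1 sum.union_disjoint add_divide_distrib distrib_left)
    finally show ?thesis .
  qed
qed

section \<open>Error bounds from the coefficients of the matrix\<close>

text \<open>The factor \<open>1 - t\<close> comes from the hypothesis on \<open>pi_coef\<close> or \<open>gamma_coef\<close> and the quotient from the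
  cone; the influence of the tail leaves at least \<open>t / 2\<close> of the main term.\<close>

lemma cone_constant_le:
  fixes t :: real
  assumes "0 < t" "t < 1"
  shows "(1 - t) * ((4 - t) / (4 - 3 * t)) \<le> 1 - t / 2"
proof -
  have "(1 - t) * (4 - t) \<le> (1 - t / 2) * (4 - 3 * t)"
    using zero_le_square[of t] by (simp add: algebra_simps)
  then show ?thesis using assms by (simp add: pos_divide_le_eq)
qed

text \<open>Test \<open>A *v \<Delta>\<close> against the dual vector w of the restriction of \<Delta> to I. From below, the block I
  contributes the numerator of \<open>omega_quot\<close>, of which the tail cancels at most the part
  \<open>1 - t / 2\<close>. From above, only the entries in F count: outside F, w has the signs of \<Delta> and
  \<open>A *v \<Delta>\<close> has the opposite ones. This is why the bound involves the cardinality of F and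
  not that of I.\<close>

lemma error_bound_dual:
  fixes A :: "real ^ 'd ^ 'd" and \<Delta> :: "real ^ 'd"
  assumes p: "1 \<le> p" and t: "0 < t" "t < 1" and m: "0 < m" and g: "0 \<le> g"
    and sym: "transpose A = A"
    and F: "F \<noteq> {}" "F \<subseteq> I" and l: "1 \<le> l" "card (I - F) = l" "l \<le> card (- I)"
    and top: "\<forall>j\<in>I - F. \<forall>i\<in>- I. \<bar>\<Delta> $ i\<bar> \<le> \<bar>\<Delta> $ j\<bar>"
    and cone: "(\<Sum>i\<in>- F. \<bar>\<Delta> $ i\<bar>) \<le> (4 - t) / (4 - 3 * t) * (\<Sum>i\<in>F. \<bar>\<Delta> $ i\<bar>)"
    and grad: "\<And>j. \<bar>(A *v \<Delta>) $ j\<bar> \<le> g" and sign: "\<And>j. j \<notin> F \<Longrightarrow> \<Delta> $ j * (A *v \<Delta>) $ j \<le> 0"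
    and omega: "\<And>v. v \<in> nonzero_on I \<Longrightarrow> ereal m \<le> omega_quot p A I v"
    and pi: "\<And>J v u. \<lbrakk>card J = l; I \<inter> J = {}; v \<in> nonzero_on I; u \<in> nonzero_on J\<rbrakk> \<Longrightarrow>
      pi_quot p A I J v u \<le> ereal ((1 - t) * real l / real (card F) powr (1 - recip p))"
  shows "t * m * lp_norm p (restrict_vec I \<Delta>) \<le> 2 * g * real (card F) powr recip p"
proof (cases "restrict_vec I \<Delta> = 0")
  case True
  then show ?thesis using p g by simp
next
  case False
  define v where "v = restrict_vec I \<Delta>"
  define w where "w = dual_vec p v"
  define N where "N = lp_norm p v"
  define K where "K = real (card F) powr (1 - recip p)"
  define q where "q = v \<bullet> (A *v w)"
  define c where "c = (1 - t) * real l / K"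
  define \<Phi> where "\<Phi> u = - (w \<bullet> (A *v u))" for u
  have v: "v \<in> nonzero_on I" "v \<noteq> 0" using False by (auto simp: v_def nonzero_on_def)
  have N: "0 < N" using v p lp_norm_pos by (simp add: N_def)
  have D: "0 < dual_scale p v" using v p dual_scale_pos by blast
  have K: "0 < K" using F by (simp add: K_def card_gt_0_iff)
  have c: "0 \<le> c" using t K by (simp add: c_def)
  have w_sgn: "w $ j = \<bar>w $ j\<bar> * sgn (v $ j)" for j
    unfolding w_def by (rule dual_vec_component[OF v(2)])
  have w_supp: "w $ j = 0" if "j \<notin> I" for j
    using w_sgn[of j] that by (simp add: v_def)
  have inner_restrict: "z \<bullet> restrict_vec I y = z \<bullet> y" if "\<And>j. j \<notin> I \<Longrightarrow> z $ j = 0" for z y :: "real ^ 'd"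
    using that by (auto simp: inner_vec_def intro!: sum.cong)
  have q_block: "v \<bullet> (block A I I *v w) = q"
    using w_supp by (simp add: q_def block_mult_vec inner_restrict v_def)
  have "ereal m \<le> ratio (ereal (max 0 q)) (ereal (dual_scale p v))"
    using omega[OF v(1)] by (simp only: omega_quot_dual q_block flip: w_def)
  also have "\<dots> = ereal (max 0 q / dual_scale p v)"
    using D by (simp add: ratio_def max_def)
  finally have "m \<le> max 0 q / dual_scale p v" by (simp only: ereal_less_eq)
  then have mD: "m * dual_scale p v \<le> max 0 q" using D by (simp add: field_simps)
  then have q: "0 < q" "m * dual_scale p v \<le> q"
    using mult_pos_pos[OF m D] by (auto simp: max_def split: if_splits)
  have \<Phi>_bound: "\<Phi> u \<le> (c * q / N) * infnorm u"
    if J: "J \<subseteq> - I" "card J = l" "u \<in> nonzero_on J" for J u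
  proof -
    have u: "- u \<in> nonzero_on J" "u \<noteq> 0" "\<And>j. j \<notin> J \<Longrightarrow> (- u) $ j = 0"
      using J by (auto simp: nonzero_on_def)
    have U: "0 < infnorm u" using u infnorm_pos_lt by blast
    have "w \<bullet> (block A I J *v (- u)) = \<Phi> u"
      using w_supp u(3) block_mult_vec[of J "- u" A I]
      by (simp add: inner_restrict \<Phi>_def matrix_vector_mult_uminus)
    moreover have "pi_quot p A I J v (- u) \<le> ereal c"
      unfolding c_def K_def using J v u by (intro pi) auto
    moreover have "max 0 q = q" using q by simp
    ultimately have "ratio (ereal (\<Phi> u * N)) (ereal (q * infnorm u)) \<le> ereal c"
      by (simp only: pi_quot_dual q_block lp_norm_infinity infnorm_neg flip: w_def N_def)
    then have "\<Phi> u * N / (q * infnorm u) \<le> c" using q U by (simp add: ratio_def)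
    then show ?thesis using q N U by (simp add: field_simps)
  qed
  have "\<Phi> (restrict_vec (- I) \<Delta>) \<le> (c * q / N) * ((\<Sum>i\<in>(I - F) \<union> - I. \<bar>\<Delta> $ i\<bar>) / real l)"
  proof (rule subadditive_tail_bound[where R = "- I" and l = l])
    show "\<Phi> (u + u') \<le> \<Phi> u + \<Phi> u'" for u u'
      by (simp add: \<Phi>_def matrix_vector_right_distrib inner_right_distrib)
  qed (use \<Phi>_bound c q N l top in \<open>auto simp: \<Phi>_def\<close>)
  also have "(I - F) \<union> - I = - F" using F by auto
  also have "(c * q / N) * ((\<Sum>i\<in>- F. \<bar>\<Delta> $ i\<bar>) / real l)
      \<le> (c * q / N) * (((4 - t) / (4 - 3 * t) * (K * N)) / real l)"
  proof (intro mult_left_mono divide_right_mono)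
    have "(\<Sum>i\<in>F. \<bar>\<Delta> $ i\<bar>) = (\<Sum>i\<in>F. \<bar>v $ i\<bar>)"
      using F by (intro sum.cong) (auto simp: v_def)
    also have "\<dots> \<le> K * N"
      unfolding K_def N_def by (rule l1_restrict_le_lp_norm[OF p F(1)])
    finally have "(4 - t) / (4 - 3 * t) * (\<Sum>i\<in>F. \<bar>\<Delta> $ i\<bar>) \<le> (4 - t) / (4 - 3 * t) * (K * N)"
      using t by (intro mult_left_mono) auto
    then show "(\<Sum>i\<in>- F. \<bar>\<Delta> $ i\<bar>) \<le> (4 - t) / (4 - 3 * t) * (K * N)"
      using cone by linarith
  qed (use c q N in auto)
  also have "\<dots> = ((1 - t) * ((4 - t) / (4 - 3 * t))) * q"
    using N K l by (simp add: c_def)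
  also have "\<dots> \<le> (1 - t / 2) * q"
    using cone_constant_le[OF t] q by (intro mult_right_mono) auto
  finally have tail: "\<Phi> (restrict_vec (- I) \<Delta>) \<le> (1 - t / 2) * q" .
  \<comment> \<open>Symmetry of A turns the quadratic expression in \<open>omega_quot\<close> into the main term.\<close>
  have "\<Delta> = v + restrict_vec (- I) \<Delta>" by (simp add: v_def vec_eq_iff)
  then have "w \<bullet> (A *v \<Delta>) = w \<bullet> (A *v v) + w \<bullet> (A *v restrict_vec (- I) \<Delta>)"
    by (metis matrix_vector_right_distrib inner_right_distrib)
  also have "w \<bullet> (A *v v) = q"
    using dot_lmul_matrix[of v A w] transpose_matrix_vector[of A v] sym
    by (simp only: q_def inner_commute)
  finally have split: "w \<bullet> (A *v \<Delta>) = q + w \<bullet> (A *v restrict_vec (- I) \<Delta>)" .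
  have lower: "t / 2 * (m * dual_scale p v) \<le> w \<bullet> (A *v \<Delta>)"
  proof -
    have "t / 2 * (m * dual_scale p v) \<le> t / 2 * q" using q t by (intro mult_left_mono) auto
    then show ?thesis using tail split by (simp add: \<Phi>_def algebra_simps)
  qed
  have "w \<bullet> (A *v \<Delta>) = (\<Sum>j\<in>UNIV. w $ j * (A *v \<Delta>) $ j)" by (simp add: inner_vec_def)
  also have "\<dots> \<le> (\<Sum>j\<in>UNIV. if j \<in> F then \<bar>w $ j\<bar> * g else 0)"
  proof (rule sum_mono)
    fix j
    show "w $ j * (A *v \<Delta>) $ j \<le> (if j \<in> F then \<bar>w $ j\<bar> * g else 0)"
    proof (cases "j \<in> F")
      case True
      have "w $ j * (A *v \<Delta>) $ j \<le> \<bar>w $ j\<bar> * \<bar>(A *v \<Delta>) $ j\<bar>"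
        by (metis abs_ge_self abs_mult)
      also have "\<dots> \<le> \<bar>w $ j\<bar> * g" using grad by (intro mult_left_mono) auto
      finally show ?thesis using True by simp
    next
      case False
      have "sgn (v $ j) * (A *v \<Delta>) $ j \<le> 0"
        using sign[OF False] by (auto simp: v_def sgn_if mult_le_0_iff)
      then have "\<bar>w $ j\<bar> * (sgn (v $ j) * (A *v \<Delta>) $ j) \<le> 0"
        by (simp add: mult_nonneg_nonpos)
      then have "w $ j * (A *v \<Delta>) $ j \<le> 0" by (metis mult.assoc w_sgn)
      then show ?thesis using False by simp
    qed
  qed
  also have "\<dots> = (\<Sum>j\<in>F. \<bar>w $ j\<bar>) * g" by (simp add: sum.If_cases sum_distrib_right)
  finally have upper: "w \<bullet> (A *v \<Delta>) \<le> (\<Sum>j\<in>F. \<bar>w $ j\<bar>) * g" .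
  have "t / 2 * (m * dual_scale p v) * N \<le> (\<Sum>j\<in>F. \<bar>w $ j\<bar>) * g * N"
    using lower upper N by (intro mult_right_mono) auto
  also have "\<dots> = g * ((\<Sum>j\<in>F. \<bar>w $ j\<bar>) * N)" by simp
  also have "\<dots> \<le> g * (real (card F) powr recip p * dual_scale p v)"
    unfolding w_def N_def using g by (intro mult_left_mono dual_vec_l1_bound p v F) auto
  finally have "(t / 2 * m * N) * dual_scale p v \<le> (g * real (card F) powr recip p) * dual_scale p v"
    by (simp add: algebra_simps)
  then have "t / 2 * m * N \<le> g * real (card F) powr recip p" using D by simp
  then show ?thesis by (simp add: N_def v_def)
qed

text \<open>Here the rows I of \<open>A *v \<Delta>\<close> are solved for the restriction v of \<Delta> to I: v is the inverse block
  applied to these rows, minus the contribution of the tail. The p-norm of the first is bounded by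
  \<open>mu_coef\<close> and that of the second by \<open>gamma_coef\<close>. No signs are used, so the entries in all
  of I count in the right-hand side.\<close>

lemma error_bound_inverse:
  fixes A :: "real ^ 'd ^ 'd" and \<Delta> :: "real ^ 'd"
  assumes p: "1 \<le> p" and t: "0 < t" "t < 1" and m: "0 < m" and g: "0 \<le> g"
    and F: "F \<noteq> {}" "F \<subseteq> I" and l: "1 \<le> l" "card (I - F) = l" "l \<le> card (- I)"
    and top: "\<forall>j\<in>I - F. \<forall>i\<in>- I. \<bar>\<Delta> $ i\<bar> \<le> \<bar>\<Delta> $ j\<bar>"
    and cone: "(\<Sum>i\<in>- F. \<bar>\<Delta> $ i\<bar>) \<le> (4 - t) / (4 - 3 * t) * (\<Sum>i\<in>F. \<bar>\<Delta> $ i\<bar>)"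
    and grad: "\<And>j. \<bar>(A *v \<Delta>) $ j\<bar> \<le> g"
    and B: "is_block_inverse A I B"
    and mu: "\<And>v. v \<in> nonzero_on I \<Longrightarrow> m * lp_norm p v \<le> lp_norm p (block A I I *v v)"
    and gamma: "\<And>J u. \<lbrakk>card J = l; I \<inter> J = {}; u \<in> nonzero_on J\<rbrakk> \<Longrightarrow>
      lp_norm p (B *v (block A I J *v u))
        \<le> ((1 - t) * real l / real (card F) powr (1 - recip p)) * infnorm u"
  shows "t * m * lp_norm p (restrict_vec I \<Delta>) \<le> 2 * g * real (card I) powr recip p"
proof -
  define v where "v = restrict_vec I \<Delta>"
  define N where "N = lp_norm p v"
  define K where "K = real (card F) powr (1 - recip p)"
  define c where "c = (1 - t) * real l / K"
  define \<Phi> where "\<Phi> u = lp_norm p (B *v restrict_vec I (A *v u))" for u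
  define r where "r = restrict_vec I (A *v \<Delta>)"
  have N: "0 \<le> N" using p lp_norm_nonneg by (simp add: N_def)
  have K: "0 < K" using F by (simp add: K_def card_gt_0_iff)
  have c: "0 \<le> c" using t K by (simp add: c_def)
  have B_left: "B *v (block A I I *v u) = restrict_vec I u" for u
  proof -
    have "B *v (block A I I *v u) = block (mat 1) I I *v u"
      using B by (simp add: is_block_inverse_def matrix_vector_mul_assoc)
    also have "\<dots> = restrict_vec I u"
      by (rule block_unit_mult_vec)
    finally show ?thesis .
  qed
  have B_right: "block A I I *v (B *v u) = restrict_vec I u" for u
  proof -
    have "block A I I *v (B *v u) = block (mat 1) I I *v u"
      using B by (simp add: is_block_inverse_def matrix_vector_mul_assoc)
    also have "\<dots> = restrict_vec I u"
      by (rule block_unit_mult_vec)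
    finally show ?thesis .
  qed
  have B_supp: "(B *v u) $ j = 0" if "j \<notin> I" for u j
  proof -
    have "block B I I = B" using B by (simp add: is_block_inverse_def)
    then have "(B *v u) $ j = (block B I I *v u) $ j" by simp
    then show ?thesis using that by (simp add: block_def matrix_vector_mult_def)
  qed
  have "\<Phi> (restrict_vec (- I) \<Delta>) \<le> c * ((\<Sum>i\<in>(I - F) \<union> - I. \<bar>\<Delta> $ i\<bar>) / real l)"
  proof (rule subadditive_tail_bound[where R = "- I" and l = l])
    show "\<Phi> (u + u') \<le> \<Phi> u + \<Phi> u'" for u u'
      using lp_norm_triangle[OF p]
      by (simp add: \<Phi>_def matrix_vector_right_distrib restrict_vec_add)
    show "\<Phi> u \<le> c * infnorm u" if "J \<subseteq> - I" "card J = l" "u \<in> nonzero_on J" for J u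
      using gamma[of J u] that block_mult_vec[of J u A I]
      by (auto simp: \<Phi>_def c_def K_def nonzero_on_def)
    show "\<Phi> 0 = 0"
      using p by (simp add: \<Phi>_def)
  qed (use c l top in auto)
  also have "(I - F) \<union> - I = - F" using F by auto
  also have "c * ((\<Sum>i\<in>- F. \<bar>\<Delta> $ i\<bar>) / real l) \<le> c * (((4 - t) / (4 - 3 * t) * (K * N)) / real l)"
  proof (intro mult_left_mono divide_right_mono)
    have "(\<Sum>i\<in>F. \<bar>\<Delta> $ i\<bar>) = (\<Sum>i\<in>F. \<bar>v $ i\<bar>)"
      using F by (intro sum.cong) (auto simp: v_def)
    also have "\<dots> \<le> K * N"
      unfolding K_def N_def by (rule l1_restrict_le_lp_norm[OF p F(1)])
    finally have "(4 - t) / (4 - 3 * t) * (\<Sum>i\<in>F. \<bar>\<Delta> $ i\<bar>) \<le> (4 - t) / (4 - 3 * t) * (K * N)"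
      using t by (intro mult_left_mono) auto
    then show "(\<Sum>i\<in>- F. \<bar>\<Delta> $ i\<bar>) \<le> (4 - t) / (4 - 3 * t) * (K * N)"
      using cone by linarith
  qed (use c in auto)
  also have "\<dots> = ((1 - t) * ((4 - t) / (4 - 3 * t))) * N"
    using K l by (simp add: c_def)
  also have "\<dots> \<le> (1 - t / 2) * N"
    using cone_constant_le[OF t] N by (intro mult_right_mono) auto
  finally have tail: "\<Phi> (restrict_vec (- I) \<Delta>) \<le> (1 - t / 2) * N" .
  have "v = restrict_vec I v" by (simp add: v_def vec_eq_iff)
  also have "\<dots> = B *v (block A I I *v v)" by (rule B_left[symmetric])
  also have "\<dots> = B *v restrict_vec I (A *v v)" by (simp add: block_mult_vec v_def)
  also have "A *v v = A *v \<Delta> + A *v (- restrict_vec (- I) \<Delta>)"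
  proof -
    have "v = \<Delta> + (- restrict_vec (- I) \<Delta>)" by (simp add: v_def vec_eq_iff)
    then show ?thesis by (metis matrix_vector_right_distrib)
  qed
  also have "B *v restrict_vec I (A *v \<Delta> + A *v (- restrict_vec (- I) \<Delta>))
      = B *v r + - (B *v restrict_vec I (A *v restrict_vec (- I) \<Delta>))"
    by (simp only: r_def restrict_vec_add restrict_vec_minus matrix_vector_right_distrib
        matrix_vector_mult_uminus)
  finally have "N \<le> lp_norm p (B *v r) + \<Phi> (restrict_vec (- I) \<Delta>)"
    using lp_norm_triangle[OF p, of "B *v r" "- (B *v restrict_vec I (A *v restrict_vec (- I) \<Delta>))"]
    by (simp add: N_def \<Phi>_def)
  then have "t / 2 * N \<le> lp_norm p (B *v r)" using tail by (simp add: algebra_simps)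
  moreover have "m * lp_norm p (B *v r) \<le> g * real (card I) powr recip p"
  proof (cases "B *v r = 0")
    case True
    then show ?thesis using p g by simp
  next
    case False
    then have "m * lp_norm p (B *v r) \<le> lp_norm p (restrict_vec I r)"
      using mu[of "B *v r"] B_supp by (simp add: nonzero_on_def B_right)
    also have "\<dots> \<le> real (card I) powr recip p * g"
      using F grad g by (intro lp_norm_le_bound p) (auto simp: r_def)
    finally show ?thesis by (simp add: mult.commute)
  qed
  ultimately have "m * (t / 2 * N) \<le> g * real (card I) powr recip p"
    using m by (meson mult_left_mono less_imp_le order_trans)
  then show ?thesis by (simp add: N_def v_def algebra_simps)
qed

section \<open>Optimality conditions of the lasso\<close>

lemma linear_term_nonneg:
  fixes a e :: real
  assumes "\<And>\<theta>. \<lbrakk>0 < \<theta>; \<theta> < 1\<rbrakk> \<Longrightarrow> 0 \<le> \<theta> * a + \<theta>\<^sup>2 * e"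
  shows "0 \<le> a"
proof (rule ccontr)
  assume a: "\<not> 0 \<le> a"
  define \<theta> where "\<theta> = min (1 / 2) (- a / (2 * (\<bar>e\<bar> + 1)))"
  have "0 < - a / (2 * (\<bar>e\<bar> + 1))" using a by (intro divide_pos_pos) auto
  then have \<theta>: "0 < \<theta>" "\<theta> < 1" by (auto simp: \<theta>_def)
  have "\<theta> * e \<le> \<theta> * (\<bar>e\<bar> + 1)" using \<theta> by (intro mult_left_mono) auto
  also have "\<dots> \<le> - a / (2 * (\<bar>e\<bar> + 1)) * (\<bar>e\<bar> + 1)"
    by (intro mult_right_mono) (auto simp: \<theta>_def)
  also have "\<dots> = - a / 2" by (simp add: field_simps)
  finally have "a + \<theta> * e < 0" using a by simp
  then have "\<theta> * (a + \<theta> * e) < 0" using \<theta> by (simp add: mult_pos_neg)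
  then show False using assms[OF \<theta>] by (simp add: algebra_simps power2_eq_square)
qed

text \<open>The objective along one coordinate is a quadratic plus \<open>lam * \<bar>b + h\<bar>\<close>. The first claim comes from
  small steps h of either sign; moving b towards 0 and comparing with the first claim gives the second.
  For nonzero b they say \<open>c = - (lam / 2) * sgn b\<close>.\<close>

lemma kink_minimum:
  fixes b c q lam :: real
  assumes min: "\<And>h. 0 \<le> 2 * h * c + h\<^sup>2 * q + lam * (\<bar>b + h\<bar> - \<bar>b\<bar>)" and lam: "0 \<le> lam"
  shows "\<bar>c\<bar> \<le> lam / 2" and "c * b = - (lam / 2) * \<bar>b\<bar>"
proof -
  have dir: "0 \<le> 2 * s * c + lam" if s: "\<bar>s\<bar> = 1" for s
  proof (rule linear_term_nonneg[where e = q])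
    fix \<theta> :: real
    assume \<theta>: "0 < \<theta>" "\<theta> < 1"
    have "\<bar>b + \<theta> * s\<bar> \<le> \<bar>b\<bar> + \<theta>" using s \<theta> abs_triangle_ineq[of b "\<theta> * s"] by (simp add: abs_mult)
    then have "lam * (\<bar>b + \<theta> * s\<bar> - \<bar>b\<bar>) \<le> lam * \<theta>" using lam by (intro mult_left_mono) auto
    moreover have "s\<^sup>2 = 1" using s by (metis power2_abs one_power2)
    ultimately show "0 \<le> \<theta> * (2 * s * c + lam) + \<theta>\<^sup>2 * q"
      using min[of "\<theta> * s"] by (simp add: algebra_simps power_mult_distrib)
  qed
  show c: "\<bar>c\<bar> \<le> lam / 2" using dir[of 1] dir[of "- 1"] by simp
  have "0 \<le> - 2 * b * c - lam * \<bar>b\<bar>"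
  proof (rule linear_term_nonneg[where e = "b\<^sup>2 * q"])
    fix \<theta> :: real
    assume \<theta>: "0 < \<theta>" "\<theta> < 1"
    have "b + - \<theta> * b = (1 - \<theta>) * b" by (simp add: algebra_simps)
    then have "\<bar>b + - \<theta> * b\<bar> = (1 - \<theta>) * \<bar>b\<bar>" using \<theta> by (simp add: abs_mult)
    then have eq: "\<bar>b + - \<theta> * b\<bar> - \<bar>b\<bar> = - \<theta> * \<bar>b\<bar>" by (simp add: algebra_simps)
    have "0 \<le> 2 * (- \<theta> * b) * c + (- \<theta> * b)\<^sup>2 * q + lam * (- \<theta> * \<bar>b\<bar>)"
      using min[of "- \<theta> * b"] unfolding eq .
    then show "0 \<le> \<theta> * (- 2 * b * c - lam * \<bar>b\<bar>) + \<theta>\<^sup>2 * (b\<^sup>2 * q)"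
      by (simp add: algebra_simps power_mult_distrib)
  qed
  moreover have "\<bar>c * b\<bar> \<le> lam / 2 * \<bar>b\<bar>"
    unfolding abs_mult using c by (intro mult_right_mono) auto
  ultimately show "c * b = - (lam / 2) * \<bar>b\<bar>" by (simp add: algebra_simps abs_le_iff)
qed

text \<open>Minus half the gradient of the square loss at \<open>\<beta>\<close>. At the target it is the correlation of the
  noise with the design.\<close>

definition residual_correlation ::
    "nat \<Rightarrow> (nat \<Rightarrow> real ^ 'd) \<Rightarrow> (nat \<Rightarrow> real) \<Rightarrow> real ^ 'd \<Rightarrow> real ^ 'd" where
  "residual_correlation n x y \<beta> = (\<chi> j. (1 / real n) * (\<Sum>i=1..n. (y i - \<beta> \<bullet> x i) * x i $ j))"

lemma lasso_objective_coordinate: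
  "lasso_objective n x y lam (\<beta> + axis j h) =
     lasso_objective n x y lam \<beta> - 2 * h * residual_correlation n x y \<beta> $ j
       + h\<^sup>2 * ((1 / real n) * (\<Sum>i=1..n. (x i $ j)\<^sup>2)) + lam * (\<bar>\<beta> $ j + h\<bar> - \<bar>\<beta> $ j\<bar>)"
proof -
  have ax: "axis j h \<bullet> x i = h * x i $ j" for i
    by (simp add: inner_commute[of "axis j h"] inner_axis)
  have sq: "((\<beta> + axis j h) \<bullet> x i - y i)\<^sup>2
      = (\<beta> \<bullet> x i - y i)\<^sup>2 + (- (2 * h)) * ((y i - \<beta> \<bullet> x i) * x i $ j) + h\<^sup>2 * (x i $ j)\<^sup>2" for i
    by (simp add: inner_add_left ax power2_eq_square algebra_simps)
  have "(\<Sum>i\<in>UNIV. \<bar>(\<beta> + axis j h) $ i\<bar>) = \<bar>\<beta> $ j + h\<bar> + (\<Sum>i\<in>UNIV - {j}. \<bar>\<beta> $ i\<bar>)"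
    by (subst sum.remove[of _ j]) (auto simp: axis_def intro!: sum.cong)
  moreover have "(\<Sum>i\<in>UNIV. \<bar>\<beta> $ i\<bar>) = \<bar>\<beta> $ j\<bar> + (\<Sum>i\<in>UNIV - {j}. \<bar>\<beta> $ i\<bar>)"
    by (rule sum.remove) auto
  ultimately have l1: "lp_norm 1 (\<beta> + axis j h) = lp_norm 1 \<beta> + (\<bar>\<beta> $ j + h\<bar> - \<bar>\<beta> $ j\<bar>)"
    by (simp add: lp_norm_one)
  show ?thesis
    unfolding lasso_objective_def l1 sq sum.distrib sum_distrib_left[symmetric] residual_correlation_def
    by (simp add: algebra_simps)
qed

lemma lasso_optimality:
  assumes "lasso_solution n x y lam \<beta>" "0 \<le> lam"
  shows "\<bar>residual_correlation n x y \<beta> $ j\<bar> \<le> lam / 2"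
    and "residual_correlation n x y \<beta> $ j * \<beta> $ j = lam / 2 * \<bar>\<beta> $ j\<bar>"
proof -
  have min: "0 \<le> 2 * h * (- residual_correlation n x y \<beta> $ j)
      + h\<^sup>2 * ((1 / real n) * (\<Sum>i=1..n. (x i $ j)\<^sup>2)) + lam * (\<bar>\<beta> $ j + h\<bar> - \<bar>\<beta> $ j\<bar>)" for h
  proof -
    have "lasso_objective n x y lam \<beta> \<le> lasso_objective n x y lam (\<beta> + axis j h)"
      using assms(1) by (simp add: is_arg_min_linorder)
    then show ?thesis by (simp add: lasso_objective_coordinate)
  qed
  show "\<bar>residual_correlation n x y \<beta> $ j\<bar> \<le> lam / 2"
    and "residual_correlation n x y \<beta> $ j * \<beta> $ j = lam / 2 * \<bar>\<beta> $ j\<bar>"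
    using kink_minimum[OF min assms(2)] by simp_all
qed

lemma gram_mult_component:
  "(gram n x *v u) $ j = (1 / real n) * (\<Sum>i=1..n. (u \<bullet> x i) * x i $ j)"
proof -
  have "(gram n x *v u) $ j = (\<Sum>s\<in>UNIV. \<Sum>i=1..n. (1 / real n) * (x i $ j * x i $ s * u $ s))"
    by (simp add: gram_def matrix_vector_mult_def sum_distrib_left sum_distrib_right mult_ac)
  also have "\<dots> = (\<Sum>i=1..n. \<Sum>s\<in>UNIV. (1 / real n) * (x i $ j * x i $ s * u $ s))"
    by (rule sum.swap)
  also have "\<dots> = (1 / real n) * (\<Sum>i=1..n. (u \<bullet> x i) * x i $ j)"
    by (simp add: inner_vec_def sum_distrib_left sum_distrib_right mult_ac)
  finally show ?thesis .
qed

lemma gram_quadratic_form: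
  "u \<bullet> (gram n x *v u) = (1 / real n) * (\<Sum>i=1..n. (u \<bullet> x i)\<^sup>2)"
proof -
  have "u \<bullet> (gram n x *v u) = (\<Sum>j\<in>UNIV. \<Sum>i=1..n. (1 / real n) * ((u \<bullet> x i) * (u $ j * x i $ j)))"
    unfolding inner_vec_def[of u "gram n x *v u"] gram_mult_component
    by (simp add: sum_distrib_left mult_ac)
  also have "\<dots> = (\<Sum>i=1..n. \<Sum>j\<in>UNIV. (1 / real n) * ((u \<bullet> x i) * (u $ j * x i $ j)))"
    by (rule sum.swap)
  also have "\<dots> = (\<Sum>i=1..n. (1 / real n) * ((u \<bullet> x i) * (u \<bullet> x i)))"
    unfolding sum_distrib_left[symmetric] by (simp add: inner_vec_def)
  finally show ?thesis by (simp add: power2_eq_square sum_distrib_left)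
qed

lemma transpose_gram: "transpose (gram n x) = gram n x"
  by (simp add: transpose_def gram_def vec_eq_iff mult.commute)

lemma gram_mult_error:
  "gram n x *v (\<beta> - \<beta>') = residual_correlation n x y \<beta>' - residual_correlation n x y \<beta>"
proof -
  have "(gram n x *v (\<beta> - \<beta>')) $ j = (residual_correlation n x y \<beta>' - residual_correlation n x y \<beta>) $ j" for j
    by (simp add: gram_mult_component residual_correlation_def inner_diff_left algebra_simps
        sum_subtractf sum.distrib flip: right_diff_distrib)
  then show ?thesis by (simp add: vec_eq_iff)
qed

text \<open>The quadratic form of the Gram matrix at \<Delta> is nonnegative, and it is the inner product of \<Delta> with the
  difference of two residual correlations. That of the solution contributes
  \<open>- (lam / 2) * \<bar>\<Delta> $ j\<bar>\<close> off F, where \<Delta> coincides with the solution, and at most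
  \<open>(lam / 2) * \<bar>\<Delta> $ j\<bar>\<close> on F.\<close>

lemma lasso_cone:
  assumes sol: "lasso_solution n x y lam \<beta>" "0 \<le> lam"
    and noise: "\<And>j. \<bar>residual_correlation n x y \<beta>' $ j\<bar> \<le> s"
    and F: "\<And>j. j \<notin> F \<Longrightarrow> \<beta>' $ j = 0"
  shows "(lam / 2 - s) * (\<Sum>j\<in>- F. \<bar>(\<beta> - \<beta>') $ j\<bar>) \<le> (lam / 2 + s) * (\<Sum>j\<in>F. \<bar>(\<beta> - \<beta>') $ j\<bar>)"
proof -
  define \<Delta> where "\<Delta> = \<beta> - \<beta>'"
  let ?z = "residual_correlation n x y \<beta>'" and ?c = "residual_correlation n x y \<beta>"
  have "0 \<le> \<Delta> \<bullet> (gram n x *v \<Delta>)" by (simp add: gram_quadratic_form sum_nonneg)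
  also have "\<dots> = (\<Sum>j\<in>UNIV. \<Delta> $ j * (?z $ j - ?c $ j))"
    unfolding \<Delta>_def gram_mult_error[of n x \<beta> \<beta>' y] by (simp add: inner_vec_def)
  also have "\<dots> \<le> (\<Sum>j\<in>UNIV. if j \<in> F then (lam / 2 + s) * \<bar>\<Delta> $ j\<bar> else - (lam / 2 - s) * \<bar>\<Delta> $ j\<bar>)"
  proof (rule sum_mono)
    fix j
    have z: "\<Delta> $ j * ?z $ j \<le> s * \<bar>\<Delta> $ j\<bar>"
    proof -
      have "\<Delta> $ j * ?z $ j \<le> \<bar>?z $ j\<bar> * \<bar>\<Delta> $ j\<bar>" by (metis abs_ge_self abs_mult mult.commute)
      also have "\<dots> \<le> s * \<bar>\<Delta> $ j\<bar>" using noise by (intro mult_right_mono) auto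
      finally show ?thesis .
    qed
    show "\<Delta> $ j * (?z $ j - ?c $ j)
        \<le> (if j \<in> F then (lam / 2 + s) * \<bar>\<Delta> $ j\<bar> else - (lam / 2 - s) * \<bar>\<Delta> $ j\<bar>)"
    proof (cases "j \<in> F")
      case True
      have "- (\<Delta> $ j * ?c $ j) \<le> \<bar>?c $ j\<bar> * \<bar>\<Delta> $ j\<bar>" by (metis abs_ge_minus_self abs_mult mult.commute)
      also have "\<dots> \<le> lam / 2 * \<bar>\<Delta> $ j\<bar>"
        using lasso_optimality(1)[OF sol] by (intro mult_right_mono) auto
      finally show ?thesis using True z by (simp add: algebra_simps)
    next
      case False
      then have "\<Delta> $ j * ?c $ j = lam / 2 * \<bar>\<Delta> $ j\<bar>"
        using lasso_optimality(2)[OF sol, of j] F by (simp add: \<Delta>_def mult.commute)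
      then show ?thesis using False z by (simp add: algebra_simps)
    qed
  qed
  also have "\<dots> = (lam / 2 + s) * (\<Sum>j\<in>F. \<bar>\<Delta> $ j\<bar>) - (lam / 2 - s) * (\<Sum>j\<in>- F. \<bar>\<Delta> $ j\<bar>)"
    by (simp add: sum.If_cases sum_distrib_left sum_negf Compl_eq algebra_simps sum_subtractf)
  finally show ?thesis by (simp add: \<Delta>_def)
qed

section \<open>Reading the extended-real hypotheses\<close>

text \<open>The coefficient C may be infinite; then every real m is below it, and a large one is chosen.
  A zero denominator makes the ratio infinite and contradicts the bound.\<close>

lemma ratio_le_finite:
  assumes "0 \<le> X" "0 \<le> r" "0 < t" "0 \<le> C" "ratio (ereal X) (ereal r * C) \<le> ereal t"
  obtains m where "0 < m" "ereal m \<le> C" "X \<le> t * r * m"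
proof (cases C)
  case (real c)
  have "r * c \<noteq> 0" using assms real by (auto simp: ratio_def)
  then have "0 < r" "0 < c" using assms real by (auto simp: order_less_le)
  then show ?thesis using assms real that[of c] by (simp add: ratio_def field_simps)
next
  case PInf
  have "0 < r" using assms PInf by (auto simp: ratio_def order_less_le)
  then have "0 < X / (t * r) + 1" "X \<le> t * r * (X / (t * r) + 1)"
    using assms by (auto simp: field_simps intro: add_nonneg_pos)
  then show ?thesis using PInf that by simp
next
  case MInf
  then show ?thesis using assms by simp
qed

lemma ereal_le_one_minus:
  assumes "ereal t \<le> 1 - P * ereal K / ereal L" "0 < K" "0 < L"
  shows "P \<le> ereal ((1 - t) * L / K)"
proof (cases P)
  case (real r)
  then show ?thesis using assms by (simp add: one_ereal_def field_simps)
qed (use assms in \<open>auto simp: one_ereal_def\<close>)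

lemma omega_coef_nonneg: "1 \<le> p \<Longrightarrow> 0 \<le> omega_coef p A k"
  unfolding omega_coef_def
proof (intro INF_greatest)
  fix I and v :: "real ^ 'a"
  assume "1 \<le> p" "v \<in> nonzero_on I"
  then have "0 < dual_scale p v" by (auto simp: nonzero_on_def intro: dual_scale_pos)
  then show "0 \<le> omega_quot p A I v"
    by (simp add: omega_quot_dual ratio_def max_def)
qed

lemma mu_coef_nonneg: "1 \<le> p \<Longrightarrow> 0 \<le> mu_coef p A k"
  unfolding mu_coef_def
proof (intro INF_greatest)
  fix I and v :: "real ^ 'a"
  assume "1 \<le> p" "v \<in> nonzero_on I"
  then have "0 < lp_norm p v" "0 \<le> lp_norm p (block A I I *v v)"
    by (auto simp: nonzero_on_def intro: lp_norm_pos lp_norm_nonneg)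
  then show "0 \<le> ratio (ereal (lp_norm p (block A I I *v v))) (ereal (lp_norm p v))"
    by (simp add: ratio_def)
qed

section \<open>The deterministic bound\<close>

text \<open>If the noise correlation vanishes, then the solution and \<open>\<beta>'\<close> solve the same normal equations and give
  the same fitted values.\<close>

lemma lasso_unpenalized:
  assumes n: "1 \<le> n" and sol: "lasso_solution n x y 0 \<beta>"
    and noise: "residual_correlation n x y \<beta>' = 0"
  shows "lasso_solution n x y 0 \<beta>'"
proof -
  have "residual_correlation n x y \<beta> = 0"
    using lasso_optimality(1)[OF sol] by (simp add: vec_eq_iff)
  then have "gram n x *v (\<beta> - \<beta>') = 0" using noise gram_mult_error[of n x \<beta> \<beta>' y] by simp
  then have "(\<Sum>i=1..n. ((\<beta> - \<beta>') \<bullet> x i)\<^sup>2) = 0"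
    using gram_quadratic_form[of "\<beta> - \<beta>'" n x] n by simp
  then have "\<beta> \<bullet> x i = \<beta>' \<bullet> x i" if "i \<in> {1..n}" for i
    using that by (subst (asm) sum_nonneg_eq_0_iff) (auto simp: inner_diff_left)
  then have "lasso_objective n x y 0 \<beta>' = lasso_objective n x y 0 \<beta>"
    by (simp add: lasso_objective_def)
  then show ?thesis using sol by (simp add: is_arg_min_linorder)
qed

text \<open>The hypothesis on \<open>lam\<close> says \<open>s \<le> lam * t / (4 * (2 - t))\<close>. This turns the cone of \<open>lasso_cone\<close> into
  the one with constant \<open>(4 - t) / (4 - 3 * t)\<close>, and implies \<open>s \<le> lam / 4\<close>, which fixes the signs
  off the support and makes \<open>2 * g\<close> at most \<open>3 / 2 * lam\<close>; the factor 8 in the hypothesis on t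
  covers this constant. An empty support is treated separately, since the cone then forces \<open>\<Delta> = 0\<close>.\<close>

lemma lasso_sup_error:
  fixes x :: "nat \<Rightarrow> real ^ 'd" and \<beta> \<beta>' :: "real ^ 'd"
  assumes n: "1 \<le> n" and sol: "lasso_solution n x y lam \<beta>" and lam: "0 \<le> lam"
    and uniq: "\<And>b. lam = 0 \<Longrightarrow> lasso_solution n x y lam b \<Longrightarrow> b = \<beta>"
    and noise: "\<And>j. \<bar>residual_correlation n x y \<beta>' $ j\<bar> \<le> s" and s: "0 \<le> s"
    and k: "card (supp_above 0 \<beta>') = k"
    and l: "1 \<le> l" "real l \<le> (real CARD('d) - real k) / 2"
    and t: "0 < t" "t < 1" and p: "1 \<le> p" and r: "0 \<le> r"
    and lam_s: "4 * (2 - t) / t * s \<le> lam"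
    and cond:
      "ratio (ereal (8 * real k powr recip p * lam)) (ereal r * omega_coef p (gram n x) (k + l)) \<le> ereal t \<and>
       ereal t \<le> 1 - pi_coef p (gram n x) (k + l) l * ereal (real k powr (1 - recip p)) / ereal (real l)
       \<or>
       ratio (ereal (8 * real (k + l) powr recip p * lam)) (ereal r * mu_coef p (gram n x) (k + l)) \<le> ereal t \<and>
       ereal t \<le> 1 - gamma_coef p (gram n x) (k + l) l * ereal (real k powr (1 - recip p)) / ereal (real l)"
  shows "infnorm (\<beta> - \<beta>') \<le> r"
proof (cases "lam = 0")
  case True
  have "s = 0"
  proof (rule ccontr)
    assume "s \<noteq> 0"
    then have "0 < 4 * (2 - t) / t * s" using s t by (intro mult_pos_pos divide_pos_pos) auto
    then show False using lam_s True by linarith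
  qed
  then have "residual_correlation n x y \<beta>' = 0" using noise by (simp add: vec_eq_iff)
  then have "\<beta>' = \<beta>" using uniq True lasso_unpenalized[OF n] sol by blast
  then show ?thesis using r by (simp add: infnorm_0)
next
  case False
  then have lam_pos: "0 < lam" using lam by simp
  define A where "A = gram n x"
  define \<Delta> where "\<Delta> = \<beta> - \<beta>'"
  define F where "F = supp_above 0 \<beta>'"
  define g where "g = lam / 2 + s"
  have \<beta>'_F: "\<beta>' $ j = 0" if "j \<notin> F" for j using that by (simp add: F_def supp_above_def)
  have s_le: "s \<le> lam * t / (4 * (2 - t))" using lam_s t by (simp add: field_simps)
  have "t / (2 - t) \<le> 1" using t by simp
  then have "lam * t / (4 * (2 - t)) \<le> lam / 4"
    using mult_left_mono[of "t / (2 - t)" 1 "lam / 4"] lam by simp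
  with s_le have "s \<le> lam / 4" by (rule order_trans)
  then have g: "0 \<le> g" "2 * g \<le> 3 / 2 * lam" "s \<le> lam / 2"
    using s lam by (auto simp: g_def)
  have cone: "(\<Sum>j\<in>- F. \<bar>\<Delta> $ j\<bar>) \<le> (4 - t) / (4 - 3 * t) * (\<Sum>j\<in>F. \<bar>\<Delta> $ j\<bar>)"
  proof -
    define \<rho> where "\<rho> = lam * t / (4 * (2 - t))"
    define u where "u = lam / (4 * (2 - t))"
    have u: "0 < u" "lam / 2 - \<rho> = u * (4 - 3 * t)" "lam / 2 + \<rho> = u * (4 - t)"
      using t lam_pos by (auto simp: u_def \<rho>_def field_simps)
    have "(lam / 2 - \<rho>) * (\<Sum>j\<in>- F. \<bar>\<Delta> $ j\<bar>) \<le> (lam / 2 - s) * (\<Sum>j\<in>- F. \<bar>\<Delta> $ j\<bar>)"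
      using s_le by (intro mult_right_mono) (auto simp: \<rho>_def sum_nonneg)
    also have "\<dots> \<le> (lam / 2 + s) * (\<Sum>j\<in>F. \<bar>\<Delta> $ j\<bar>)"
      unfolding \<Delta>_def by (rule lasso_cone[OF sol lam noise \<beta>'_F])
    also have "\<dots> \<le> (lam / 2 + \<rho>) * (\<Sum>j\<in>F. \<bar>\<Delta> $ j\<bar>)"
      using s_le by (intro mult_right_mono) (auto simp: \<rho>_def sum_nonneg)
    finally have "u * ((4 - 3 * t) * (\<Sum>j\<in>- F. \<bar>\<Delta> $ j\<bar>)) \<le> u * ((4 - t) * (\<Sum>j\<in>F. \<bar>\<Delta> $ j\<bar>))"
      unfolding u by (simp only: mult.assoc)
    then have "(4 - 3 * t) * (\<Sum>j\<in>- F. \<bar>\<Delta> $ j\<bar>) \<le> (4 - t) * (\<Sum>j\<in>F. \<bar>\<Delta> $ j\<bar>)"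
      using u(1) by simp
    then show ?thesis using t by (simp add: pos_le_divide_eq mult.commute)
  qed
  show ?thesis
  proof (cases "k = 0")
    case True
    then have F: "F = {}" using k by (simp add: F_def)
    then have "(\<Sum>j\<in>UNIV. \<bar>\<Delta> $ j\<bar>) \<le> 0" using cone by simp
    then have "\<bar>\<Delta> $ j\<bar> \<le> 0" for j
      using member_le_sum[of j UNIV "\<lambda>j. \<bar>\<Delta> $ j\<bar>"] by simp
    then show ?thesis unfolding \<Delta>_def[symmetric] infnorm_le_iff using r order_trans by blast
  next
    case k_pos: False
    have cF: "card F = k" "F \<noteq> {}" using k k_pos by (auto simp: F_def)
    have "real (k + 2 * l) \<le> real CARD('d)" using l(2) by (simp add: field_simps)
    then have dim: "k + 2 * l \<le> CARD('d)" by (simp only: of_nat_le_iff)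
    have card_Compl: "card (- S) = CARD('d) - card S" for S :: "'d set"
      by (simp add: Compl_eq_Diff_UNIV card_Diff_subset)
    have "card (- F) = CARD('d) - k" using cF by (simp add: card_Compl)
    then have "l \<le> card (- F)" using dim by linarith
    then obtain J where J: "J \<subseteq> - F" "card J = l" "\<forall>j\<in>J. \<forall>i\<in>- F - J. \<bar>\<Delta> $ i\<bar> \<le> \<bar>\<Delta> $ j\<bar>"
      using exists_largest_subset[of "- F" l "\<lambda>i. \<bar>\<Delta> $ i\<bar>"] by auto
    define I where "I = F \<union> J"
    have IF: "I - F = J" "- I = - F - J" using J by (auto simp: I_def)
    have cI: "card I = k + l"
      using J cF unfolding I_def by (subst card_Un_disjoint) auto
    have I: "F \<subseteq> I" "card (I - F) = l" using J IF by (auto simp: I_def)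
    have l_le: "l \<le> card (- I)" using card_Compl[of I] cI dim by linarith
    have top: "\<forall>j\<in>I - F. \<forall>i\<in>- I. \<bar>\<Delta> $ i\<bar> \<le> \<bar>\<Delta> $ j\<bar>" using J IF by auto
    have A\<Delta>: "(A *v \<Delta>) $ j = residual_correlation n x y \<beta>' $ j - residual_correlation n x y \<beta> $ j" for j
      unfolding A_def \<Delta>_def gram_mult_error[of n x \<beta> \<beta>' y] by simp
    have grad: "\<bar>(A *v \<Delta>) $ j\<bar> \<le> g" for j
      using noise[of j] lasso_optimality(1)[OF sol lam, of j] unfolding A\<Delta> g_def by linarith
    have sign: "\<Delta> $ j * (A *v \<Delta>) $ j \<le> 0" if "j \<notin> F" for j
    proof -
      have "\<Delta> $ j = \<beta> $ j" using \<beta>'_F[OF that] by (simp add: \<Delta>_def)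
      then have "\<Delta> $ j * (A *v \<Delta>) $ j = residual_correlation n x y \<beta>' $ j * \<beta> $ j - lam / 2 * \<bar>\<beta> $ j\<bar>"
        using lasso_optimality(2)[OF sol lam, of j] by (simp add: A\<Delta> algebra_simps)
      moreover have "residual_correlation n x y \<beta>' $ j * \<beta> $ j \<le> lam / 2 * \<bar>\<beta> $ j\<bar>"
      proof -
        have "residual_correlation n x y \<beta>' $ j * \<beta> $ j \<le> \<bar>residual_correlation n x y \<beta>' $ j\<bar> * \<bar>\<beta> $ j\<bar>"
          by (metis abs_ge_self abs_mult)
        also have "\<dots> \<le> lam / 2 * \<bar>\<beta> $ j\<bar>"
          using noise[of j] g by (intro mult_right_mono) auto
        finally show ?thesis .
      qed
      ultimately show ?thesis by simp
    qed
    define N where "N = lp_norm p (restrict_vec I \<Delta>)"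
    have K: "0 < real k powr (1 - recip p)" using k_pos by simp
    have L: "0 < real l" using l by simp
    let ?c = "(1 - t) * real l / real k powr (1 - recip p)"
    \<comment> \<open>Both alternatives of the hypothesis lead to this bound, with different m and \<open>\<kappa>\<close>.\<close>
    have "\<exists>m \<kappa>. 0 < m \<and> 0 \<le> \<kappa> \<and> 8 * \<kappa> * lam \<le> t * r * m \<and> t * m * N \<le> 2 * g * \<kappa>"
      using cond
    proof (elim disjE conjE, fold A_def)
      assume 1: "ratio (ereal (8 * real k powr recip p * lam)) (ereal r * omega_coef p A (k + l)) \<le> ereal t"
        and 2: "ereal t \<le> 1 - pi_coef p A (k + l) l * ereal (real k powr (1 - recip p)) / ereal (real l)"
      obtain m where m: "0 < m" "ereal m \<le> omega_coef p A (k + l)" "8 * real k powr recip p * lam \<le> t * r * m"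
        using ratio_le_finite[OF _ r t(1) omega_coef_nonneg[OF p] 1] lam by auto
      have pi: "pi_coef p A (k + l) l \<le> ereal ?c" by (rule ereal_le_one_minus[OF 2 K L])
      have "t * m * N \<le> 2 * g * real (card F) powr recip p"
        unfolding N_def
      proof (rule error_bound_dual[OF p t m(1) g(1) _ cF(2) I(1) l(1) I(2) l_le top cone grad sign])
        show "transpose A = A" by (simp add: A_def transpose_gram)
        show "ereal m \<le> omega_quot p A I v" if "v \<in> nonzero_on I" for v
          using order_trans[OF m(2)] that cI unfolding omega_coef_def by (blast intro: INF_lower2 order_refl)
        show "pi_quot p A I J v u \<le> ereal ((1 - t) * real l / real (card F) powr (1 - recip p))"
          if "card J = l" "I \<inter> J = {}" "v \<in> nonzero_on I" "u \<in> nonzero_on J" for J v u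
        proof -
          have "pi_quot p A I J v u \<le> pi_coef p A (k + l) l"
            unfolding pi_coef_def using that cI
            by (intro SUP_upper2[of I] SUP_upper2[of J] SUP_upper2[of v] SUP_upper2[of u]) auto
          then show ?thesis using pi cF by simp
        qed
      qed
      then show ?thesis using m cF by (intro exI[of _ m] exI[of _ "real k powr recip p"]) simp
    next
      assume 1: "ratio (ereal (8 * real (k + l) powr recip p * lam)) (ereal r * mu_coef p A (k + l)) \<le> ereal t"
        and 2: "ereal t \<le> 1 - gamma_coef p A (k + l) l * ereal (real k powr (1 - recip p)) / ereal (real l)"
      obtain m where m: "0 < m" "ereal m \<le> mu_coef p A (k + l)" "8 * real (k + l) powr recip p * lam \<le> t * r * m"
        using ratio_le_finite[OF _ r t(1) mu_coef_nonneg[OF p] 1] lam by auto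
      have gamma: "gamma_coef p A (k + l) l \<le> ereal ?c" by (rule ereal_le_one_minus[OF 2 K L])
      have inv: "\<not> (\<exists>I. card I = k + l \<and> \<not> (\<exists>B. is_block_inverse A I B))"
      proof
        assume "\<exists>I. card I = k + l \<and> \<not> (\<exists>B. is_block_inverse A I B)"
        then have "gamma_coef p A (k + l) l = \<infinity>" unfolding gamma_coef_def by (rule if_P)
        then show False using gamma by simp
      qed
      have "t * m * N \<le> 2 * g * real (card I) powr recip p"
        unfolding N_def
      proof (rule error_bound_inverse[OF p t m(1) g(1) cF(2) I(1) l(1) I(2) l_le top cone grad])
        show "is_block_inverse A I (block_inverse A I)"
          using inv cI is_block_inverse_block_inverse by blast
        show "m * lp_norm p v \<le> lp_norm p (block A I I *v v)" if v: "v \<in> nonzero_on I" for v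
        proof -
          have N: "0 < lp_norm p v" using v by (auto simp: nonzero_on_def intro: lp_norm_pos p)
          have "mu_coef p A (k + l) \<le> ratio (ereal (lp_norm p (block A I I *v v))) (ereal (lp_norm p v))"
            unfolding mu_coef_def using v cI by (intro INF_lower2[of I] INF_lower2[of v]) auto
          then have "ereal m \<le> ratio (ereal (lp_norm p (block A I I *v v))) (ereal (lp_norm p v))"
            using m(2) order_trans by blast
          then show ?thesis using N by (simp add: ratio_def field_simps)
        qed
        show "lp_norm p (block_inverse A I *v (block A I J *v u))
            \<le> (1 - t) * real l / real (card F) powr (1 - recip p) * infnorm u"
          if J: "card J = l" "I \<inter> J = {}" and u: "u \<in> nonzero_on J" for J u
        proof -
          have U: "0 < infnorm u" using u by (auto simp: nonzero_on_def infnorm_pos_lt)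
          have "ratio (ereal (lp_norm p (block_inverse A I *v (block A I J *v u)))) (ereal (lp_norm \<infinity> u))
              \<le> gamma_coef p A (k + l) l"
            unfolding gamma_coef_def if_not_P[OF inv] using J u cI
            by (intro SUP_upper2[of I] SUP_upper2[of J] SUP_upper2[of u]) auto
          also note gamma
          finally have "lp_norm p (block_inverse A I *v (block A I J *v u)) / infnorm u \<le> ?c"
            using U by (simp add: ratio_def)
          then show ?thesis unfolding cF(1) pos_divide_le_eq[OF U] .
        qed
      qed
      then show ?thesis
        using m cI by (intro exI[of _ m] exI[of _ "real (k + l) powr recip p"]) simp
    qed
    then obtain m \<kappa> where m: "0 < m" "0 \<le> \<kappa>" "8 * \<kappa> * lam \<le> t * r * m" "t * m * N \<le> 2 * g * \<kappa>"
      by blast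
    have "2 * g * \<kappa> \<le> 8 * lam * \<kappa>"
      using g lam m by (intro mult_right_mono) auto
    also have "\<dots> = 8 * \<kappa> * lam" by simp
    finally have "t * m * N \<le> t * r * m" using m by linarith
    also have "\<dots> = t * m * r" by simp
    finally have "N \<le> r" using t m by (simp add: mult_le_cancel_left_pos)
    moreover have on_I: "\<bar>\<Delta> $ j\<bar> \<le> N" if "j \<in> I" for j
      using component_le_lp_norm[OF p, of "restrict_vec I \<Delta>" j] that by (simp add: N_def)
    moreover have "\<bar>\<Delta> $ j\<bar> \<le> N" if j: "j \<notin> I" for j
    proof -
      have "I - F \<noteq> {}" using I(2) l(1) by (metis card.empty not_one_le_zero)
      then obtain i where i: "i \<in> I - F" by blast
      then have "\<bar>\<Delta> $ j\<bar> \<le> \<bar>\<Delta> $ i\<bar>" using top j by blast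
      also have "\<dots> \<le> N" using on_I i by blast
      finally show ?thesis .
    qed
    ultimately have "\<bar>\<Delta> $ j\<bar> \<le> r" for j by (meson order_trans)
    then show ?thesis unfolding \<Delta>_def[symmetric] infnorm_le_iff by blast
  qed
qed

lemma supp_above_sandwich:
  assumes "infnorm (\<beta> - \<beta>') \<le> \<epsilon> * \<alpha>"
  shows "supp_above ((1 + \<epsilon>) * \<alpha>) \<beta>' \<subseteq> supp_above \<alpha> \<beta>"
    and "supp_above \<alpha> \<beta> \<subseteq> supp_above ((1 - \<epsilon>) * \<alpha>) \<beta>'"
proof -
  have "\<bar>\<beta> $ j - \<beta>' $ j\<bar> \<le> \<epsilon> * \<alpha>" for j
    using assms by (simp add: infnorm_le_iff)
  then have le: "\<bar>\<beta>' $ j\<bar> \<le> \<bar>\<beta> $ j\<bar> + \<epsilon> * \<alpha>" "\<bar>\<beta> $ j\<bar> \<le> \<bar>\<beta>' $ j\<bar> + \<epsilon> * \<alpha>" for j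
    using abs_triangle_ineq2[of "\<beta>' $ j" "\<beta> $ j"] abs_triangle_ineq2[of "\<beta> $ j" "\<beta>' $ j"]
    by (metis abs_minus_commute add.commute diff_le_eq order_trans)+
  show "supp_above ((1 + \<epsilon>) * \<alpha>) \<beta>' \<subseteq> supp_above \<alpha> \<beta>"
    unfolding supp_above_def
  proof clarify
    fix j
    assume "(1 + \<epsilon>) * \<alpha> < \<bar>\<beta>' $ j\<bar>"
    then show "\<alpha> < \<bar>\<beta> $ j\<bar>" using le(1)[of j] unfolding distrib_right by linarith
  qed
  show "supp_above \<alpha> \<beta> \<subseteq> supp_above ((1 - \<epsilon>) * \<alpha>) \<beta>'"
    unfolding supp_above_def
  proof clarify
    fix j
    assume "\<alpha> < \<bar>\<beta> $ j\<bar>"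
    then show "(1 - \<epsilon>) * \<alpha> < \<bar>\<beta>' $ j\<bar>" using le(2)[of j] unfolding left_diff_distrib by linarith
  qed
qed

section \<open>Concentration of the noise\<close>

text \<open>Chernoff's bound with strict inequality, which the theorem needs to get a probability strictly above
  \<open>1 - \<delta>\<close>. It is strict because \<open>exp (\<theta> * (S - \<tau>))\<close> exceeds the indicator of \<open>\<tau> < S\<close> everywhere. If
  W is 0, the threshold is 0 and the bound is trivial for every \<theta>; instead the hypothesis at \<theta> = 1 and -1 forces the hyperbolic cosine of S, which is
  at least 1, to have mean 1, so that S vanishes almost surely.\<close>

lemma (in prob_space) subgaussian_tail:
  fixes S :: "'a \<Rightarrow> real"
  assumes [measurable]: "S \<in> borel_measurable M"
    and int: "\<And>\<theta>. integrable M (\<lambda>x. exp (\<theta> * S x))"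
    and mgf: "\<And>\<theta>. (\<integral>x. exp (\<theta> * S x) \<partial>M) \<le> exp (W * \<theta>\<^sup>2 / 2)"
    and W: "0 \<le> W" and L: "0 < L"
  shows "prob {x \<in> space M. sqrt (2 * W * L) < S x} < exp (- L)"
proof (cases "W = 0")
  case True
  have "(\<integral>x. exp (S x) + exp (- S x) - 2 \<partial>M) \<le> 0"
    using mgf[of 1] mgf[of "- 1"] int[of 1] int[of "- 1"] True by (simp add: prob_space)
  moreover have nonneg: "0 \<le> exp z + exp (- z) - 2" for z :: real
    using cosh_real_ge_1[of z] by (simp add: cosh_def)
  moreover have int2: "integrable M (\<lambda>x. exp (S x) + exp (- S x) - 2)"
    using int[of 1] int[of "- 1"] by simp
  ultimately have "(\<integral>x. exp (S x) + exp (- S x) - 2 \<partial>M) = 0"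
    by (intro antisym integral_nonneg) auto
  then have "AE x in M. exp (S x) + exp (- S x) - 2 = 0"
    using integral_nonneg_eq_0_iff_AE[OF int2] nonneg by auto
  then have "AE x in M. S x \<le> 0"
  proof (rule AE_mp, intro AE_I2 impI)
    fix x
    assume "exp (S x) + exp (- S x) - 2 = 0"
    then have "cosh (S x) = 1" by (simp add: cosh_def)
    then show "S x \<le> 0" by simp
  qed
  then have "prob {x \<in> space M. 0 < S x} = 0"
    by (subst prob_eq_0) (auto elim!: AE_mp)
  then show ?thesis using True by simp
next
  case False
  then have W: "0 < W" using W by simp
  define \<tau> where "\<tau> = sqrt (2 * W * L)"
  define \<theta> where "\<theta> = \<tau> / W"
  have \<tau>: "0 < \<tau>" "\<tau>\<^sup>2 = 2 * W * L" using W L by (auto simp: \<tau>_def)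
  have \<theta>: "0 < \<theta>" using \<tau> W by (simp add: \<theta>_def)
  have "prob {x \<in> space M. \<tau> < S x} = (\<integral>x. indicator {x \<in> space M. \<tau> < S x} x \<partial>M)"
    by simp
  also have "\<dots> < (\<integral>x. exp (- \<theta> * \<tau>) * exp (\<theta> * S x) \<partial>M)"
  proof (rule integral_less_AE_space)
    show "AE x in M. indicator {x \<in> space M. \<tau> < S x} x < exp (- \<theta> * \<tau>) * exp (\<theta> * S x)"
    proof (intro AE_I2)
      fix x
      show "indicator {x \<in> space M. \<tau> < S x} x < exp (- \<theta> * \<tau>) * exp (\<theta> * S x)"
        using \<theta> by (auto simp: indicator_def simp flip: exp_add)
    qed
    show "emeasure M (space M) \<noteq> 0" by (simp add: emeasure_space_1)
  qed (use int in \<open>auto simp: fmeasurable_def less_top[symmetric]\<close>)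
  also have "\<dots> \<le> exp (- \<theta> * \<tau>) * exp (W * \<theta>\<^sup>2 / 2)"
    using mgf[of \<theta>] by simp
  also have "\<dots> = exp (- L)"
    using W \<tau> by (simp add: \<theta>_def power_divide power2_eq_square flip: exp_add)
  finally show ?thesis unfolding \<tau>_def .
qed

lemma (in prob_space) weighted_sum_mgf:
  fixes y :: "nat \<Rightarrow> 'a \<Rightarrow> real" and c :: "nat \<Rightarrow> real"
  assumes indep: "indep_vars (\<lambda>_. borel) y I" and fin: "finite I"
    and int: "\<And>i t. i \<in> I \<Longrightarrow> integrable M (\<lambda>w. exp (t * (y i w - e i)))"
    and mgf: "\<And>i t. i \<in> I \<Longrightarrow> (\<integral>w. exp (t * (y i w - e i)) \<partial>M) \<le> exp (\<sigma>\<^sup>2 * t\<^sup>2 / 2)"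
  shows "integrable M (\<lambda>w. exp (\<theta> * (\<Sum>i\<in>I. (y i w - e i) * c i)))" (is ?int)
    and "(\<integral>w. exp (\<theta> * (\<Sum>i\<in>I. (y i w - e i) * c i)) \<partial>M)
      \<le> exp ((\<sigma>\<^sup>2 * (\<Sum>i\<in>I. (c i)\<^sup>2)) * \<theta>\<^sup>2 / 2)" (is ?bound)
proof -
  have prod: "exp (\<theta> * (\<Sum>i\<in>I. (y i w - e i) * c i)) = (\<Prod>i\<in>I. exp ((\<theta> * c i) * (y i w - e i)))" for w
    by (simp add: sum_distrib_left mult_ac flip: exp_sum[OF fin])
  have ind: "indep_vars (\<lambda>_. borel) (\<lambda>i w. exp ((\<theta> * c i) * (y i w - e i))) I"
    by (rule indep_vars_compose2[OF indep]) simp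
  show ?int unfolding prod by (rule indep_vars_integrable[OF fin ind int])
  have "(\<integral>w. exp (\<theta> * (\<Sum>i\<in>I. (y i w - e i) * c i)) \<partial>M)
      = (\<Prod>i\<in>I. \<integral>w. exp ((\<theta> * c i) * (y i w - e i)) \<partial>M)"
    unfolding prod by (rule indep_vars_lebesgue_integral[OF fin ind int])
  also have "\<dots> \<le> (\<Prod>i\<in>I. exp (\<sigma>\<^sup>2 * (\<theta> * c i)\<^sup>2 / 2))"
    using mgf by (intro prod_mono) auto
  also have "\<dots> = exp ((\<sigma>\<^sup>2 * (\<Sum>i\<in>I. (c i)\<^sup>2)) * \<theta>\<^sup>2 / 2)"
    using fin by (simp add: exp_sum[symmetric] power_mult_distrib sum_distrib_left sum_distrib_right
        sum_divide_distrib mult_ac)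
  finally show ?bound .
qed

text \<open>Each of the \<open>2 * CARD('d)\<close> signed entries exceeds the threshold with probability below
  \<open>\<delta> / (2 * CARD('d))\<close>. The variance proxy of n times an entry is at most \<open>\<sigma>\<^sup>2 * n * a\<^sup>2\<close>, because the
  diagonal of the Gram matrix is bounded by \<open>a\<^sup>2\<close>.\<close>

lemma (in prob_space) correlation_concentration:
  fixes x :: "nat \<Rightarrow> real ^ 'd" and y :: "nat \<Rightarrow> 'a \<Rightarrow> real"
  assumes n: "1 \<le> n" and indep: "indep_vars (\<lambda>_. borel) y {1..n}" and \<sigma>: "0 \<le> \<sigma>"
    and int: "\<And>i t. i \<in> {1..n} \<Longrightarrow> integrable M (\<lambda>w. exp (t * (y i w - \<beta>' \<bullet> x i)))"
    and mgf: "\<And>i t. i \<in> {1..n} \<Longrightarrow> (\<integral>w. exp (t * (y i w - \<beta>' \<bullet> x i)) \<partial>M) \<le> exp (\<sigma>\<^sup>2 * t\<^sup>2 / 2)"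
    and \<delta>: "0 < \<delta>" "\<delta> < 1"
    and a: "a = sqrt (SUP j. gram n x $ j $ j)"
    and s: "s = \<sigma> * a * sqrt (2 * ln (2 * real CARD('d) / \<delta>) / real n)"
  defines "E \<equiv> {w \<in> space M. \<forall>j. \<bar>residual_correlation n x (\<lambda>i. y i w) \<beta>' $ j\<bar> \<le> s}"
  shows "E \<in> sets M" and "prob E > 1 - \<delta>" and "0 \<le> s"
proof -
  have y_meas [measurable]: "y i \<in> borel_measurable M" if "i \<in> {1..n}" for i
    using indep that by (auto simp: indep_vars_def)
  have corr_meas [measurable]: "(\<lambda>w. residual_correlation n x (\<lambda>i. y i w) \<beta>' $ j) \<in> borel_measurable M" for j
    unfolding residual_correlation_def vec_lambda_beta by measurable
  show E: "E \<in> sets M" unfolding E_def by measurable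
  define L where "L = ln (2 * real CARD('d) / \<delta>)"
  have card: "1 \<le> real CARD('d)" using zero_less_card_finite[where 'a = 'd] by linarith
  have "\<delta> < 2 * real CARD('d)" using \<delta> card by linarith
  then have ratio: "1 < 2 * real CARD('d) / \<delta>" using \<delta> by simp
  have L: "0 < L" unfolding L_def by (rule ln_gt_zero[OF ratio])
  have exp_L: "exp (- L) = \<delta> / (2 * real CARD('d))"
    using ratio by (simp add: L_def exp_minus)
  have diag: "gram n x $ j $ j = (1 / real n) * (\<Sum>i=1..n. (x i $ j)\<^sup>2)" for j
    by (simp add: gram_def power2_eq_square)
  have diag_le: "gram n x $ j $ j \<le> (SUP j. gram n x $ j $ j)" for j
    by (intro cSUP_upper) auto
  have diag_nonneg: "0 \<le> gram n x $ j $ j" for j by (simp add: diag sum_nonneg)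
  have a2: "0 \<le> a" "a\<^sup>2 = (SUP j. gram n x $ j $ j)"
    using order_trans[OF diag_nonneg diag_le] by (auto simp: a)
  show s_nonneg: "0 \<le> s" using \<sigma> a2 L by (simp add: s L_def)
  define W where "W = \<sigma>\<^sup>2 * (real n * a\<^sup>2)"
  have W: "0 \<le> W" by (simp add: W_def)
  define \<tau> where "\<tau> = sqrt (2 * W * L)"
  have \<tau>: "\<tau> / real n = s"
  proof -
    have "2 * W * L = (real n * \<sigma> * a)\<^sup>2 * (2 * L / real n)"
      using n by (simp add: W_def power2_eq_square)
    then have "\<tau> = sqrt ((real n * \<sigma> * a)\<^sup>2) * sqrt (2 * L / real n)"
      by (simp only: \<tau>_def real_sqrt_mult)
    also have "sqrt ((real n * \<sigma> * a)\<^sup>2) = real n * \<sigma> * a"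
      using \<sigma> a2 by simp
    finally have "\<tau> = (real n * \<sigma> * a) * sqrt (2 * L / real n)" .
    then show ?thesis using n by (simp add: s L_def)
  qed
  have tail: "prob {w \<in> space M. \<tau> < (\<Sum>i=1..n. (y i w - \<beta>' \<bullet> x i) * (b * x i $ j))} < \<delta> / (2 * real CARD('d))"
    if b: "b\<^sup>2 = 1" for b :: real and j
    unfolding \<tau>_def exp_L[symmetric]
  proof (rule subgaussian_tail[OF _ _ _ W L])
    fix \<theta> :: real
    note mgf_sum = weighted_sum_mgf[OF indep finite_atLeastAtMost int mgf, where c = "\<lambda>i. b * x i $ j" and \<theta> = \<theta>]
    show "integrable M (\<lambda>w. exp (\<theta> * (\<Sum>i=1..n. (y i w - \<beta>' \<bullet> x i) * (b * x i $ j))))"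
      by (rule mgf_sum(1))
    have "(\<Sum>i=1..n. (b * x i $ j)\<^sup>2) = real n * gram n x $ j $ j"
      using n b by (simp add: diag power_mult_distrib)
    also have "\<dots> \<le> real n * a\<^sup>2" using diag_le a2 by (intro mult_left_mono) auto
    finally have "(\<sigma>\<^sup>2 * (\<Sum>i=1..n. (b * x i $ j)\<^sup>2)) * \<theta>\<^sup>2 / 2 \<le> W * \<theta>\<^sup>2 / 2"
      unfolding W_def by (intro divide_right_mono mult_right_mono mult_left_mono) auto
    then show "(\<integral>w. exp (\<theta> * (\<Sum>i=1..n. (y i w - \<beta>' \<bullet> x i) * (b * x i $ j))) \<partial>M) \<le> exp (W * \<theta>\<^sup>2 / 2)"
      using mgf_sum(2) by (meson exp_le_cancel_iff order_trans)
  qed measurable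
  define B where "B b j = {w \<in> space M. \<tau> < (\<Sum>i=1..n. (y i w - \<beta>' \<bullet> x i) * (b * x i $ j))}" for b j
  have B: "B b j \<in> sets M" for b j unfolding B_def by measurable
  have "space M - E \<subseteq> (\<Union>j. B 1 j \<union> B (- 1) j)"
  proof
    fix w
    assume w: "w \<in> space M - E"
    then obtain j where j: "s < \<bar>residual_correlation n x (\<lambda>i. y i w) \<beta>' $ j\<bar>"
      by (auto simp: E_def not_le)
    define S where "S = (\<Sum>i=1..n. (y i w - \<beta>' \<bullet> x i) * x i $ j)"
    have "\<tau> / real n < \<bar>S\<bar> / real n"
      using j unfolding \<tau> by (simp add: residual_correlation_def S_def abs_mult)
    then have "\<tau> < \<bar>S\<bar>" using n by (simp add: divide_less_cancel)
    then have "w \<in> B 1 j \<or> w \<in> B (- 1) j"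
      using w by (auto simp: B_def S_def sum_negf)
    then show "w \<in> (\<Union>j. B 1 j \<union> B (- 1) j)" by blast
  qed
  then have "prob (space M - E) \<le> prob (\<Union>j. B 1 j \<union> B (- 1) j)"
    using B by (intro finite_measure_mono) auto
  also have "\<dots> \<le> (\<Sum>j\<in>UNIV. prob (B 1 j \<union> B (- 1) j))"
    using B by (intro finite_measure_subadditive_finite) auto
  also have "\<dots> < (\<Sum>j\<in>(UNIV :: 'd set). \<delta> / real CARD('d))"
  proof (rule sum_strict_mono)
    fix j
    have "prob (B 1 j \<union> B (- 1) j) \<le> prob (B 1 j) + prob (B (- 1) j)"
      by (rule measure_Un_le[OF B B])
    also have "\<dots> < \<delta> / (2 * real CARD('d)) + \<delta> / (2 * real CARD('d))"
      unfolding B_def by (intro add_strict_mono tail) auto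
    finally show "prob (B 1 j \<union> B (- 1) j) < \<delta> / real CARD('d)" by simp
  qed auto
  also have "\<dots> = \<delta>" by simp
  finally show "prob E > 1 - \<delta>" using prob_compl[OF E] by simp
qed

section \<open>Recovery of the support\<close>

theorem theorem7p1:
  fixes M :: "'a measure"
    and n k :: nat
    and x :: "nat \<Rightarrow> real ^ 'd"
    and y :: "nat \<Rightarrow> 'a \<Rightarrow> real"
    and \<sigma> lam \<alpha> \<delta> a :: real
    and A :: "real ^ 'd ^ 'd"
    and betabar :: "real ^ 'd"
    and betahat :: "'a \<Rightarrow> real ^ 'd"
  assumes "prob_space M"
    and "1 \<le> n"
    and "prob_space.indep_vars M (\<lambda>_. borel) y {1..n}"
    and "\<And>i. i \<in> {1..n} \<Longrightarrow> integrable M (y i)"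
    and "0 \<le> \<sigma>"
    and "\<And>i t. i \<in> {1..n} \<Longrightarrow>
           integrable M (\<lambda>w. exp (t * (y i w - integral\<^sup>L M (y i))))"
    and "\<And>i t. i \<in> {1..n} \<Longrightarrow>
           (\<integral>w. exp (t * (y i w - integral\<^sup>L M (y i))) \<partial>M) \<le> exp (\<sigma>\<^sup>2 * t\<^sup>2 / 2)"
    and "A = gram n x"
    and "a = sqrt (SUP j. A $ j $ j)"
    and "\<And>i. i \<in> {1..n} \<Longrightarrow> integral\<^sup>L M (y i) = betabar \<bullet> x i"
    and "card (supp_above 0 betabar) = k"
    and "0 \<le> lam"
    and "\<And>w. w \<in> space M \<Longrightarrow> lasso_solution n x (\<lambda>i. y i w) lam (betahat w)"
    and "\<And>w b. \<lbrakk>lam = 0; w \<in> space M; lasso_solution n x (\<lambda>i. y i w) lam b\<rbrakk> \<Longrightarrow> b = betahat w"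
    and "0 \<le> \<alpha>"
    and "0 < \<delta>" and "\<delta> < 1"
  shows "\<exists>E\<in>sets M. measure M E > 1 - \<delta> \<and>
    (\<forall>w\<in>E. \<forall>\<epsilon>\<in>{0<..<1}.
      (\<exists>(l::nat) (t::real) (p::ereal).
         1 \<le> l \<and> k \<le> l \<and> real l \<le> (real CARD('d) - real k) / 2 \<and>
         0 < t \<and> t < 1 \<and> 1 \<le> p \<and>
         lam \<ge> 4 * (2 - t) / t * (\<sigma> * a * sqrt (2 * ln (2 * real CARD('d) / \<delta>) / real n)) \<and>
         (ratio (ereal (8 * real k powr recip p * lam))
                (ereal (\<epsilon> * \<alpha>) * omega_coef p A (k + l)) \<le> ereal t \<and>
          ereal t \<le> 1 - pi_coef p A (k + l) l * ereal (real k powr (1 - recip p)) / ereal (real l)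
          \<or>
          ratio (ereal (8 * real (k + l) powr recip p * lam))
                (ereal (\<epsilon> * \<alpha>) * mu_coef p A (k + l)) \<le> ereal t \<and>
          ereal t \<le> 1 - gamma_coef p A (k + l) l * ereal (real k powr (1 - recip p)) / ereal (real l)))
      \<longrightarrow>
      supp_above ((1 + \<epsilon>) * \<alpha>) betabar \<subseteq> supp_above \<alpha> (betahat w) \<and>
      supp_above \<alpha> (betahat w) \<subseteq> supp_above ((1 - \<epsilon>) * \<alpha>) betabar)"
proof -
  interpret prob_space M by (rule assms(1))
  define s where "s = \<sigma> * a * sqrt (2 * ln (2 * real CARD('d) / \<delta>) / real n)"
  define E where "E = {w \<in> space M. \<forall>j. \<bar>residual_correlation n x (\<lambda>i. y i w) betabar $ j\<bar> \<le> s}"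
  have int: "integrable M (\<lambda>w. exp (u * (y i w - betabar \<bullet> x i)))"
    and mgf: "(\<integral>w. exp (u * (y i w - betabar \<bullet> x i)) \<partial>M) \<le> exp (\<sigma>\<^sup>2 * u\<^sup>2 / 2)"
    if "i \<in> {1..n}" for i u
    using assms(6,7)[OF that, of u] assms(10)[OF that] by simp_all
  have a: "a = sqrt (SUP j. gram n x $ j $ j)" using assms(8,9) by simp
  note event = correlation_concentration[OF assms(2,3,5) int mgf assms(16,17) a s_def, folded E_def]
  show ?thesis
  proof (intro bexI[of _ E] conjI ballI impI event(1,2))
    fix w \<epsilon>
    assume w: "w \<in> E" and \<epsilon>: "\<epsilon> \<in> {0<..<(1::real)}"
    have w_space: "w \<in> space M" and noise: "\<And>j. \<bar>residual_correlation n x (\<lambda>i. y i w) betabar $ j\<bar> \<le> s"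
      using w by (auto simp: E_def)
    have r: "0 \<le> \<epsilon> * \<alpha>" using \<epsilon> assms(15) by simp
    assume "\<exists>(l::nat) (t::real) (p::ereal).
         1 \<le> l \<and> k \<le> l \<and> real l \<le> (real CARD('d) - real k) / 2 \<and>
         0 < t \<and> t < 1 \<and> 1 \<le> p \<and>
         lam \<ge> 4 * (2 - t) / t * (\<sigma> * a * sqrt (2 * ln (2 * real CARD('d) / \<delta>) / real n)) \<and>
         (ratio (ereal (8 * real k powr recip p * lam))
                (ereal (\<epsilon> * \<alpha>) * omega_coef p A (k + l)) \<le> ereal t \<and>
          ereal t \<le> 1 - pi_coef p A (k + l) l * ereal (real k powr (1 - recip p)) / ereal (real l)
          \<or>
          ratio (ereal (8 * real (k + l) powr recip p * lam))
                (ereal (\<epsilon> * \<alpha>) * mu_coef p A (k + l)) \<le> ereal t \<and>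
          ereal t \<le> 1 - gamma_coef p A (k + l) l * ereal (real k powr (1 - recip p)) / ereal (real l))"
      (is "\<exists>l t p. ?H l t p")
    then obtain l t p where H: "?H l t p" by blast
    have "infnorm (betahat w - betabar) \<le> \<epsilon> * \<alpha>"
    proof (rule lasso_sup_error[OF assms(2) assms(13)[OF w_space] assms(12) _ noise event(3) assms(11)])
      show "b = betahat w" if "lam = 0" "lasso_solution n x (\<lambda>i. y i w) lam b" for b
        using assms(14) that w_space by blast
    qed (use H r in \<open>auto simp: assms(8) s_def\<close>)
    then show "supp_above ((1 + \<epsilon>) * \<alpha>) betabar \<subseteq> supp_above \<alpha> (betahat w)"
      and "supp_above \<alpha> (betahat w) \<subseteq> supp_above ((1 - \<epsilon>) * \<alpha>) betabar"
      by (rule supp_above_sandwich)+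
  qed
qed

end
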